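(* Let $Q$ be a finite quandle. All irreducible quandle representations of $Q$ over $\mathbb{C}$ are $1$-dimensional if and only if the enveloping group $G(Q)$ is abelian.
   Context: A quandle is a set $Q$ with a binary operation $\triangleright$ such that: $x\triangleright x=x$ for all $x\in Q$; for all $x,y\in Q$ there is a unique $z\in Q$ with $x\triangleright z=y$; and $x\triangleright(y\triangleright z)=(x\triangleright y)\triangleright(x\triangleright z)$ for all $x,y,z\in Q$. A quandle representation of $Q$ on a vector space $V$ is a map $\rho:Q\to GL(V)$ with $\rho(x\triangleright y)=\rho(x)\rho(y)\rho(x)^{-1}$ for all $x,y\in Q$. It is irreducible if $V\neq 0$ and the only vector subspaces of $V$ stable under all elements of $\rho(Q)$ are $0$ and $V$. The enveloping group of $Q$ is the group given by the presentation $G(Q)=\langle x\in Q \mid xyx^{-1}=x\triangleright y \text{ for } x,y\in Q\rangle$. *)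

theory Defs
  imports "Jordan_Normal_Form.VS_Connect" "HOL-Algebra.Bij" "HOL-Library.Equipollence"
begin

section \<open>Quandles\<close>

locale quandle =
  fixes Q :: "'q set" and qop :: "'q \<Rightarrow> 'q \<Rightarrow> 'q"  (infixl \<open>\<triangleright>\<close> 70)
  assumes closed: "\<lbrakk>x \<in> Q; y \<in> Q\<rbrakk> \<Longrightarrow> x \<triangleright> y \<in> Q"
    and idem: "x \<in> Q \<Longrightarrow> x \<triangleright> x = x"
    and left_div: "\<lbrakk>x \<in> Q; y \<in> Q\<rbrakk> \<Longrightarrow> \<exists>!z. z \<in> Q \<and> x \<triangleright> z = y"
    and left_distrib:
      "\<lbrakk>x \<in> Q; y \<in> Q; z \<in> Q\<rbrakk> \<Longrightarrow> x \<triangleright> (y \<triangleright> z) = (x \<triangleright> y) \<triangleright> (x \<triangleright> z)"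


section \<open>Groups given by generators and relations\<close>

text \<open>A word over a set \<open>S\<close> of generators is a list of letters; \<open>(x, True)\<close> stands for the
  generator \<open>x\<close> and \<open>(x, False)\<close> for its formal inverse.\<close>

type_synonym 'a word = "('a \<times> bool) list"

definition words :: "'a set \<Rightarrow> 'a word set" where
  "words S = lists (S \<times> UNIV)"

text \<open>The group presented by \<open>S\<close> and \<open>R\<close> is the quotient of the monoid of words by the smallest
  congruence that cancels adjacent inverse letters and identifies \<open>u\<close> with \<open>v\<close> for all
  \<open>(u, v) \<in> R\<close>.\<close>

inductive pres_cong :: "'a set \<Rightarrow> ('a word \<times> 'a word) set \<Rightarrow> 'a word \<Rightarrow> 'a word \<Rightarrow> bool"
  for S R where
  rel: "\<lbrakk>(u, v) \<in> R; u \<in> words S; v \<in> words S\<rbrakk> \<Longrightarrow> pres_cong S R u v"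
| cancel: "x \<in> S \<Longrightarrow> pres_cong S R [(x, b), (x, \<not> b)] []"
| refl: "u \<in> words S \<Longrightarrow> pres_cong S R u u"
| sym: "pres_cong S R u v \<Longrightarrow> pres_cong S R v u"
| trans: "\<lbrakk>pres_cong S R u v; pres_cong S R v w\<rbrakk> \<Longrightarrow> pres_cong S R u w"
| mult: "\<lbrakk>pres_cong S R u u'; pres_cong S R v v'\<rbrakk> \<Longrightarrow> pres_cong S R (u @ v) (u' @ v')"

definition pres_rel :: "'a set \<Rightarrow> ('a word \<times> 'a word) set \<Rightarrow> ('a word \<times> 'a word) set" where
  "pres_rel S R = {(u, v). pres_cong S R u v}"

definition presented_group :: "'a set \<Rightarrow> ('a word \<times> 'a word) set \<Rightarrow> 'a word set monoid" where
  "presented_group S R =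
    \<lparr>carrier = words S // pres_rel S R,
     mult = \<lambda>A B. \<Union>u\<in>A. \<Union>v\<in>B. pres_rel S R `` {u @ v},
     one = pres_rel S R `` {[]}\<rparr>"

lemma words_simps [simp]:
  "[] \<in> words S"
  "l # u \<in> words S \<longleftrightarrow> fst l \<in> S \<and> u \<in> words S"
  "u @ v \<in> words S \<longleftrightarrow> u \<in> words S \<and> v \<in> words S"
  by (cases l; auto simp: words_def)+

lemma pres_cong_words: "pres_cong S R u v \<Longrightarrow> u \<in> words S \<and> v \<in> words S"
  by (induction rule: pres_cong.induct) auto

lemma equiv_pres_rel: "equiv (words S) (pres_rel S R)"
proof (rule equivI)
  show "pres_rel S R \<subseteq> words S \<times> words S"
    by (auto simp: pres_rel_def dest: pres_cong_words)
  show "refl_on (words S) (pres_rel S R)"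
    by (rule refl_onI) (simp add: pres_rel_def pres_cong.refl)
  show "sym (pres_rel S R)"
    by (rule symI) (simp add: pres_rel_def pres_cong.sym)
  show "trans (pres_rel S R)"
    by (rule transI) (simp add: pres_rel_def, rule pres_cong.trans)
qed

lemma presented_group_mult_class:
  assumes "u \<in> words S" "v \<in> words S"
  shows "pres_rel S R `` {u} \<otimes>\<^bsub>presented_group S R\<^esub> pres_rel S R `` {v} = pres_rel S R `` {u @ v}"
proof -
  have *: "pres_rel S R `` {u' @ v'} = pres_rel S R `` {u @ v}"
    if "u' \<in> pres_rel S R `` {u}" "v' \<in> pres_rel S R `` {v}" for u' v'
  proof (rule equiv_class_eq[OF equiv_pres_rel])
    have "pres_cong S R u' u" "pres_cong S R v' v"
      using that by (simp_all add: pres_rel_def pres_cong.sym)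
    then show "(u' @ v', u @ v) \<in> pres_rel S R"
      by (simp add: pres_rel_def pres_cong.mult)
  qed
  have mem: "u \<in> pres_rel S R `` {u}" "v \<in> pres_rel S R `` {v}"
    using assms by (simp_all add: pres_rel_def pres_cong.refl)
  have "(\<Union>u'\<in>pres_rel S R `` {u}. \<Union>v'\<in>pres_rel S R `` {v}. pres_rel S R `` {u' @ v'})
      = (\<Union>u'\<in>pres_rel S R `` {u}. \<Union>v'\<in>pres_rel S R `` {v}. pres_rel S R `` {u @ v})"
    by (intro SUP_cong HOL.refl *)
  also have "\<dots> = pres_rel S R `` {u @ v}"
    using mem by blast
  finally show ?thesis by (simp add: presented_group_def)
qed

lemma presented_group_carrier_cases:
  assumes "A \<in> carrier (presented_group S R)"
  obtains u where "u \<in> words S" "A = pres_rel S R `` {u}"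
  using assms by (auto simp: presented_group_def elim: quotientE)

lemma presented_group_classI:
  "u \<in> words S \<Longrightarrow> pres_rel S R `` {u} \<in> carrier (presented_group S R)"
  by (auto simp: presented_group_def intro: quotientI)

lemma presented_group_class_eqI:
  "pres_cong S R u v \<Longrightarrow> pres_rel S R `` {u} = pres_rel S R `` {v}"
  by (intro equiv_class_eq[OF equiv_pres_rel]) (simp add: pres_rel_def)

lemma presented_group_left_inverse:
  assumes "u \<in> words S"
  shows "\<exists>v \<in> words S. pres_cong S R (v @ u) []"
  using assms
proof (induction u)
  case Nil
  then show ?case by (intro bexI[of _ "[]"]) (auto intro: pres_cong.refl)
next
  case (Cons l u)
  then obtain v where v: "v \<in> words S" "pres_cong S R (v @ u) []" by auto
  obtain x b where l: "l = (x, b)" by fastforce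
  have x: "x \<in> S" and u: "u \<in> words S" using Cons.prems l by auto
  have "pres_cong S R ((v @ [(x, \<not> b), (x, b)]) @ u) ((v @ []) @ u)"
    using pres_cong.cancel[OF x, of R "\<not> b"] v(1) u
    by (intro pres_cong.mult pres_cong.refl) simp_all
  then have "pres_cong S R ((v @ [(x, \<not> b)]) @ l # u) []"
    using v(2) l by (simp add: pres_cong.trans[of S R _ "v @ u"])
  then show ?case using v(1) x by (intro bexI[of _ "v @ [(x, \<not> b)]"]) auto
qed

lemma group_presented_group: "group (presented_group S R)"
proof (rule groupI)
  let ?G = "presented_group S R"
  have one: "\<one>\<^bsub>?G\<^esub> = pres_rel S R `` {[]}" by (simp add: presented_group_def)
  show "\<one>\<^bsub>?G\<^esub> \<in> carrier ?G" unfolding one by (rule presented_group_classI) simp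
  show "A \<otimes>\<^bsub>?G\<^esub> B \<in> carrier ?G" if "A \<in> carrier ?G" "B \<in> carrier ?G" for A B
    using that
    by (auto elim!: presented_group_carrier_cases
        simp: presented_group_mult_class intro!: presented_group_classI)
  show "A \<otimes>\<^bsub>?G\<^esub> B \<otimes>\<^bsub>?G\<^esub> C = A \<otimes>\<^bsub>?G\<^esub> (B \<otimes>\<^bsub>?G\<^esub> C)"
    if "A \<in> carrier ?G" "B \<in> carrier ?G" "C \<in> carrier ?G" for A B C
    using that by (auto elim!: presented_group_carrier_cases simp: presented_group_mult_class)
  show "\<one>\<^bsub>?G\<^esub> \<otimes>\<^bsub>?G\<^esub> A = A" if "A \<in> carrier ?G" for A
    using that unfolding one
    by (auto elim!: presented_group_carrier_cases simp: presented_group_mult_class)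
  show "\<exists>B\<in>carrier ?G. B \<otimes>\<^bsub>?G\<^esub> A = \<one>\<^bsub>?G\<^esub>" if A: "A \<in> carrier ?G" for A
  proof -
    obtain u where u: "u \<in> words S" "A = pres_rel S R `` {u}"
      using A by (rule presented_group_carrier_cases)
    obtain v where v: "v \<in> words S" "pres_cong S R (v @ u) []"
      using presented_group_left_inverse[OF u(1)] by blast
    then show ?thesis
      unfolding one u(2)
      by (intro bexI[of _ "pres_rel S R `` {v}"])
        (simp_all add: presented_group_mult_class u(1) presented_group_class_eqI
          presented_group_classI)
  qed
qed

text \<open>The relations \<open>x y x\<^sup>-\<^sup>1 = x \<triangleright> y\<close> for \<open>x, y \<in> Q\<close>.\<close>

definition enveloping_group :: "'q set \<Rightarrow> ('q \<Rightarrow> 'q \<Rightarrow> 'q) \<Rightarrow> 'q word set monoid" where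
  "enveloping_group Q qop =
    presented_group Q
      {([(x, True), (y, True), (x, False)], [(qop x y, True)]) | x y. x \<in> Q \<and> y \<in> Q}"


section \<open>Quandle representations\<close>

text \<open>Linear bijections are taken extensional (\<open>undefined\<close> outside the carrier), as in
  \<^const>\<open>BijGroup\<close>, so that equality in \<open>GL K V\<close> is equality of maps on \<open>V\<close>.\<close>

definition GL :: "('k, 'm) ring_scheme \<Rightarrow> ('k, 'v, 'n) module_scheme \<Rightarrow> ('v \<Rightarrow> 'v) monoid" where
  "GL K V = BijGroup (carrier V) \<lparr>carrier := LinearCombinations.module_hom K V V \<inter> Bij (carrier V)\<rparr>"

lemma subgroup_GL:
  assumes "Module.module K V"
  shows "subgroup (LinearCombinations.module_hom K V V \<inter> Bij (carrier V)) (BijGroup (carrier V))"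
proof (rule group.subgroupI[OF group_BijGroup])
  interpret Module.module K V by fact
  show "LinearCombinations.module_hom K V V \<inter> Bij (carrier V) \<subseteq> carrier (BijGroup (carrier V))"
    by (auto simp: BijGroup_def)
  have "(\<lambda>x\<in>carrier V. x) \<in> LinearCombinations.module_hom K V V \<inter> Bij (carrier V)"
    by (auto simp: LinearCombinations.module_hom_def id_Bij)
  then show "LinearCombinations.module_hom K V V \<inter> Bij (carrier V) \<noteq> {}" by blast
  fix f assume f: "f \<in> LinearCombinations.module_hom K V V \<inter> Bij (carrier V)"
  then have lin: "f \<in> LinearCombinations.module_hom K V V" and bij: "f \<in> Bij (carrier V)" by auto
  let ?g = "inv_into (carrier V) f"
  have img: "f ` carrier V = carrier V" and inj: "inj_on f (carrier V)"
    using bij by (auto simp: Bij_def bij_betw_def)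
  have g: "?g v \<in> carrier V" "f (?g v) = v" if "v \<in> carrier V" for v
    using that img by (auto intro: inv_into_into f_inv_into_f)
  have "?g (v \<oplus>\<^bsub>V\<^esub> w) = ?g v \<oplus>\<^bsub>V\<^esub> ?g w" if "v \<in> carrier V" "w \<in> carrier V" for v w
  proof (rule inv_into_f_eq[OF inj])
    show "f (?g v \<oplus>\<^bsub>V\<^esub> ?g w) = v \<oplus>\<^bsub>V\<^esub> w"
      using LinearCombinations.module_hom_add[OF lin] g that by simp
  qed (use g that in auto)
  moreover have "?g (a \<odot>\<^bsub>V\<^esub> v) = a \<odot>\<^bsub>V\<^esub> ?g v" if "a \<in> carrier K" "v \<in> carrier V" for a v
  proof (rule inv_into_f_eq[OF inj])
    show "f (a \<odot>\<^bsub>V\<^esub> ?g v) = a \<odot>\<^bsub>V\<^esub> v"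
      using LinearCombinations.module_hom_smult[OF lin] g that by simp
  qed (use g that in auto)
  ultimately show "inv\<^bsub>BijGroup (carrier V)\<^esub> f \<in> LinearCombinations.module_hom K V V \<inter> Bij (carrier V)"
    using g restrict_inv_into_Bij[OF bij] by (simp add: inv_BijGroup[OF bij] LinearCombinations.module_hom_def)
  fix h assume h: "h \<in> LinearCombinations.module_hom K V V \<inter> Bij (carrier V)"
  have "compose (carrier V) f h \<in> LinearCombinations.module_hom K V V"
    using f h by (auto simp: LinearCombinations.module_hom_def compose_def Pi_iff)
  then show "f \<otimes>\<^bsub>BijGroup (carrier V)\<^esub> h \<in> LinearCombinations.module_hom K V V \<inter> Bij (carrier V)"
    using f h compose_Bij[of f "carrier V" h] by (simp add: BijGroup_def)
qed

lemma group_GL: "Module.module K V \<Longrightarrow> group (GL K V)"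
  unfolding GL_def by (intro subgroup.subgroup_is_group subgroup_GL group_BijGroup)

definition quandle_rep ::
    "'q set \<Rightarrow> ('q \<Rightarrow> 'q \<Rightarrow> 'q) \<Rightarrow> ('k, 'm) ring_scheme \<Rightarrow> ('k, 'v, 'n) module_scheme
      \<Rightarrow> ('q \<Rightarrow> 'v \<Rightarrow> 'v) \<Rightarrow> bool" where
  "quandle_rep Q qop K V \<rho> \<longleftrightarrow>
    vectorspace K V \<and>
    \<rho> \<in> Q \<rightarrow> carrier (GL K V) \<and>
    (\<forall>x\<in>Q. \<forall>y\<in>Q. \<rho> (qop x y) = \<rho> x \<otimes>\<^bsub>GL K V\<^esub> \<rho> y \<otimes>\<^bsub>GL K V\<^esub> inv\<^bsub>GL K V\<^esub> \<rho> x)"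

definition irreducible_quandle_rep ::
    "'q set \<Rightarrow> ('q \<Rightarrow> 'q \<Rightarrow> 'q) \<Rightarrow> ('k, 'm) ring_scheme \<Rightarrow> ('k, 'v, 'n) module_scheme
      \<Rightarrow> ('q \<Rightarrow> 'v \<Rightarrow> 'v) \<Rightarrow> bool" where
  "irreducible_quandle_rep Q qop K V \<rho> \<longleftrightarrow>
    quandle_rep Q qop K V \<rho> \<and>
    carrier V \<noteq> {\<zero>\<^bsub>V\<^esub>} \<and>
    (\<forall>W. VectorSpace.subspace K W V \<and> (\<forall>x\<in>Q. \<rho> x ` W \<subseteq> W) \<longrightarrow> W = {\<zero>\<^bsub>V\<^esub>} \<or> W = carrier V)"

text \<open>\<^const>\<open>vectorspace.dim\<close> is a natural number that means nothing for spaces that are not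
  finitely generated, hence the first conjunct.\<close>

definition has_dim :: "('k, 'm) ring_scheme \<Rightarrow> ('k, 'v, 'n) module_scheme \<Rightarrow> nat \<Rightarrow> bool" where
  "has_dim K V n \<longleftrightarrow> vectorspace.fin_dim K V \<and> vectorspace.dim K V = n"

text \<open>HOL cannot quantify over all types inside a formula, so "every complex vector space" is
  rendered as "every complex vector space whose underlying set is a subset of \<open>'v\<close>", for an
  arbitrary type \<open>'v\<close>. Nonzero complex vector spaces have at least the cardinality of the complex
  numbers; a smaller \<open>'v\<close> would carry none of them, so \<open>'v\<close> has to be assumed at least
  that large.\<close>

abbreviation complex_field :: "complex ring" where
  "complex_field \<equiv> class_ring"

end

theory Submission
  imports Defs "HOL-Algebra.Generated_Groups" "HOL-Algebra.Multiplicative_Group"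
    "HOL-Analysis.Continuum_Not_Denumerable"
    "HOL-Computational_Algebra.Fundamental_Theorem_Algebra"
begin

text \<open>If \<open>G(Q)\<close> is abelian, the operators of an irreducible representation commute. Its space has
  countable dimension, and \<open>\<complex>\<close> is uncountable, so Dixmier's form of Schur's lemma makes each
  operator a scalar.

  Conversely, let \<open>n\<close> be a common period of the left translations, so that the \<open>x\<^sup>n\<close> are central in
  \<open>G(Q)\<close>. The quotient \<open>F\<close> of \<open>G(Q)\<close> by the relations \<open>x\<^sup>n = 1\<close> is finite, and it is abelian only if
  \<open>G(Q)\<close> is. If \<open>F\<close> contains a commutator \<open>c \<noteq> 1\<close>, then the functions on \<open>F\<close> whose sums over the
  left cosets of \<open>\<langle>c\<rangle>\<close> vanish form a nonzero translation-stable space without a common eigenvector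
  of the translations, so a minimal nonzero stable subspace is irreducible of dimension greater
  than 1.\<close>

section \<open>Presented groups\<close>

text \<open>An irreducible space is not known to be finite-dimensional, so an eigenvalue cannot be
  read off a characteristic polynomial. A cyclic vector supplies the countable dimension, and a
  dimension count against the uncountably many resolvents supplies the scalar.

  For nonempty \<open>Q\<close> the group G(Q) is infinite, since the exponent sum maps it onto the
  integers, and a stable space of functions on an infinite group need not contain a minimal one.
  This is what forces the passage to a finite quotient; its price is that non-commutativity has to
  survive there.

  The condition on coset sums replaces complete reducibility and character theory: instead of
  decomposing the regular representation and looking for a summand that is not a line, it removes
  all stable lines at once. Finally, the representation has to live inside the arbitrary type
  \<open>'v\<close>; this is possible because the functions on a finite group inject into the
  complex numbers, hence into \<open>'v\<close>.\<close>

abbreviation word_class :: "'a set \<Rightarrow> ('a word \<times> 'a word) set \<Rightarrow> 'a word \<Rightarrow> 'a word set" where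
  "word_class S R u \<equiv> pres_rel S R `` {u}"

abbreviation gen_class :: "'a set \<Rightarrow> ('a word \<times> 'a word) set \<Rightarrow> 'a \<Rightarrow> 'a word set" where
  "gen_class S R x \<equiv> word_class S R [(x, True)]"

lemma word_class_eq_iff:
  assumes "u \<in> words S" "v \<in> words S"
  shows "word_class S R u = word_class S R v \<longleftrightarrow> pres_cong S R u v"
  using eq_equiv_class_iff[OF equiv_pres_rel assms] by (simp add: pres_rel_def)

lemma one_presented_group: "\<one>\<^bsub>presented_group S R\<^esub> = word_class S R []"
  by (simp add: presented_group_def)

lemma word_class_append:
  assumes "u \<in> words S" "v \<in> words S"
  shows "word_class S R (u @ v) = word_class S R u \<otimes>\<^bsub>presented_group S R\<^esub> word_class S R v"
  by (simp only: presented_group_mult_class[OF assms])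

lemma word_class_inverse_letter:
  assumes "x \<in> S"
  shows "word_class S R [(x, False)] = inv\<^bsub>presented_group S R\<^esub> gen_class S R x"
proof -
  interpret group "presented_group S R" by (rule group_presented_group)
  have "word_class S R [(x, False)] \<otimes>\<^bsub>presented_group S R\<^esub> gen_class S R x = \<one>\<^bsub>presented_group S R\<^esub>"
    using presented_group_class_eqI[OF pres_cong.cancel[OF assms, of R False]] assms
    by (simp add: presented_group_mult_class one_presented_group)
  then show ?thesis
    using assms by (intro inv_equality[symmetric]) (auto intro: presented_group_classI)
qed

lemma word_class_in_generate:
  "u \<in> words S \<Longrightarrow> word_class S R u \<in> generate (presented_group S R) (gen_class S R ` S)"
proof (induction u)
  case Nil
  show ?case by (simp add: one_presented_group[symmetric] generate.one)
next
  case (Cons l u)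
  obtain x b where l: "l = (x, b)" by fastforce
  have x: "x \<in> S" and u: "u \<in> words S" using Cons.prems l by auto
  have "word_class S R [l] \<in> generate (presented_group S R) (gen_class S R ` S)"
    using x by (cases b) (auto simp: l word_class_inverse_letter intro: generate.incl generate.inv)
  then show ?case
    using Cons.IH[OF u] word_class_append[of "[l]" S u R] x u l by (simp add: generate.eng)
qed

lemma generate_gen_class:
  "generate (presented_group S R) (gen_class S R ` S) = carrier (presented_group S R)"
proof
  show "generate (presented_group S R) (gen_class S R ` S) \<subseteq> carrier (presented_group S R)"
    by (rule group.generate_incl[OF group_presented_group]) (auto intro: presented_group_classI)
  show "carrier (presented_group S R) \<subseteq> generate (presented_group S R) (gen_class S R ` S)"
    by (auto elim!: presented_group_carrier_cases intro: word_class_in_generate)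
qed

lemma word_class_replicate:
  assumes "x \<in> S"
  shows "word_class S R (replicate n (x, True)) = gen_class S R x [^]\<^bsub>presented_group S R\<^esub> n"
proof -
  interpret group "presented_group S R" by (rule group_presented_group)
  have rep: "replicate n (x, True) \<in> words S" for n
    using assms by (induction n) auto
  show ?thesis
  proof (induction n)
    case (Suc n)
    have "word_class S R (replicate (Suc n) (x, True)) = word_class S R (replicate n (x, True) @ [(x, True)])"
      by (simp add: replicate_append_same)
    also have "\<dots> = gen_class S R x [^]\<^bsub>presented_group S R\<^esub> Suc n"
      using Suc assms rep by (subst word_class_append) auto
    finally show ?case .
  qed (simp add: one_presented_group)
qed

text \<open>The centralizer of \<open>y\<close> is a subgroup, so it contains everything generated
  by elements that commute with \<open>y\<close>.\<close>

lemma (in group) generate_commute: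
  assumes "A \<subseteq> carrier G" "y \<in> carrier G" "x \<in> generate G A"
    and comm: "\<And>a. a \<in> A \<Longrightarrow> a \<otimes> y = y \<otimes> a"
  shows "x \<otimes> y = y \<otimes> x"
  using assms(3)
proof induction
  case one
  show ?case using assms(2) by simp
next
  case (incl h)
  then show ?case by (rule comm)
next
  case (inv h)
  then have "h \<in> carrier G" "h \<otimes> y = y \<otimes> h" using assms(1) comm by auto
  then show ?case using assms(2) by (metis inv_closed inv_solve_left inv_solve_right m_assoc m_closed)
next
  case (eng h1 h2)
  then have "h1 \<in> carrier G" "h2 \<in> carrier G" using generate_in_carrier assms(1) by auto
  then show ?case using eng.IH assms(2) by (metis m_assoc)
qed

lemma (in group) comm_group_generate:
  assumes gen: "generate G A = carrier G"
    and comm: "\<And>x y. \<lbrakk>x \<in> A; y \<in> A\<rbrakk> \<Longrightarrow> x \<otimes> y = y \<otimes> x"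
  shows "comm_group G"
proof -
  have A: "A \<subseteq> carrier G" using gen generate.incl[of _ A G] by auto
  have "a \<otimes> y = y \<otimes> a" if "a \<in> A" "y \<in> carrier G" for a y
    using generate_commute[OF A, of a y] comm that A gen by (metis subsetD)
  then have "x \<otimes> y = y \<otimes> x" if "x \<in> carrier G" "y \<in> carrier G" for x y
    using generate_commute[OF A, of y x] that gen by auto
  then show ?thesis by (intro group_comm_groupI)
qed

section \<open>Groups generated by a quandle\<close>

text \<open>Serves both G(Q) and its finite quotient. The conjugation relation is written without
  inverses, and \<open>e\<close> is not assumed injective because distinct elements of
  \<open>Q\<close> may become equal in these groups.\<close>

locale quandle_generated_group = quandle Q qop + group G
  for Q :: "'q set" and qop (infixl \<open>\<triangleright>\<close> 70) and G (structure) +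
  fixes e
  assumes e_closed [simp]: "x \<in> Q \<Longrightarrow> e x \<in> carrier G"
    and e_swap: "\<lbrakk>x \<in> Q; y \<in> Q\<rbrakk> \<Longrightarrow> e x \<otimes> e y = e (x \<triangleright> y) \<otimes> e x"
    and generates: "generate G (e ` Q) = carrier G"

section \<open>Left translations as permutations\<close>

lemma (in quandle) bij_betw_left:
  assumes x: "x \<in> Q"
  shows "bij_betw ((\<triangleright>) x) Q Q"
proof (rule bij_betw_imageI)
  show "inj_on ((\<triangleright>) x) Q"
  proof (rule inj_onI)
    fix y z assume y: "y \<in> Q" and z: "z \<in> Q" and eq: "x \<triangleright> y = x \<triangleright> z"
    show "y = z"
      using left_div[OF x closed[OF x y]] y z eq by metis
  qed
  show "(\<triangleright>) x ` Q = Q"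
  proof
    show "Q \<subseteq> (\<triangleright>) x ` Q"
    proof
      fix y assume "y \<in> Q"
      then obtain z where "z \<in> Q" "x \<triangleright> z = y" using ex1_implies_ex[OF left_div[OF x]] by blast
      then show "y \<in> (\<triangleright>) x ` Q" by blast
    qed
  qed (use closed[OF x] in blast)
qed

text \<open>One exponent serves all \<open>x\<close>: the left translations lie in the finite group
  of permutations of \<open>Q\<close>, and the order of that group annihilates each of its
  elements.\<close>

lemma (in quandle) left_period:
  assumes "finite Q"
  obtains n where "n > 0" "\<And>x y. \<lbrakk>x \<in> Q; y \<in> Q\<rbrakk> \<Longrightarrow> (((\<triangleright>) x) ^^ n) y = y"
proof -
  interpret B: group "BijGroup Q" by (rule group_BijGroup)
  have "finite (carrier (BijGroup Q))"
    using finite_PiE[of Q "\<lambda>_. Q"] assms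
    by (rule_tac finite_subset[of _ "Q \<rightarrow>\<^sub>E Q"])
      (auto simp: BijGroup_def Bij_def bij_betw_def PiE_def)
  then have n: "Coset.order (BijGroup Q) > 0" by (simp add: B.order_gt_0_iff_finite)
  have "(((\<triangleright>) x) ^^ Coset.order (BijGroup Q)) y = y" if x: "x \<in> Q" and y: "y \<in> Q" for x y
  proof -
    define f where "f = restrict ((\<triangleright>) x) Q"
    have f: "f \<in> carrier (BijGroup Q)"
      using bij_betw_left[OF x] by (simp add: f_def BijGroup_def Bij_def)
    have pow: "((f [^]\<^bsub>BijGroup Q\<^esub> k) z = (((\<triangleright>) x) ^^ k) z)" if "z \<in> Q" for k z
      using that
    proof (induction k arbitrary: z)
      case (Suc k)
      have "f [^]\<^bsub>BijGroup Q\<^esub> Suc k = compose Q (f [^]\<^bsub>BijGroup Q\<^esub> k) f"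
        using f B.nat_pow_closed[OF f, of k] by (simp add: BijGroup_def)
      then have "(f [^]\<^bsub>BijGroup Q\<^esub> Suc k) z = (f [^]\<^bsub>BijGroup Q\<^esub> k) (x \<triangleright> z)"
        using Suc.prems by (simp add: compose_def f_def del: B.nat_pow_Suc)
      then show ?case
        using Suc.IH[of "x \<triangleright> z"] Suc.prems closed x by (simp add: funpow_swap1 del: B.nat_pow_Suc)
    qed (simp add: BijGroup_def)
    show ?thesis
      using pow[OF y, of "Coset.order (BijGroup Q)"] B.pow_order_eq_1[OF f] y by (simp add: BijGroup_def)
  qed
  then show ?thesis using n that by blast
qed

context quandle_generated_group
begin

lemma left_pow_closed: "\<lbrakk>x \<in> Q; y \<in> Q\<rbrakk> \<Longrightarrow> (((\<triangleright>) x) ^^ k) y \<in> Q"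
  by (induction k) (auto intro: closed)

text \<open>Conjugation by \<open>e x\<close> permutes the generators by the left translation of
  \<open>x\<close>. A period of the translation will therefore give a central power.\<close>

lemma e_pow_swap:
  assumes "x \<in> Q" "y \<in> Q"
  shows "e x [^] (k::nat) \<otimes> e y = e ((((\<triangleright>) x) ^^ k) y) \<otimes> e x [^] k"
proof (induction k)
  case (Suc k)
  let ?y = "(((\<triangleright>) x) ^^ k) y"
  have y: "?y \<in> Q" by (rule left_pow_closed[OF assms])
  have "e x [^] Suc k \<otimes> e y = e x \<otimes> (e x [^] k \<otimes> e y)"
    using assms nat_pow_Suc2[of "e x" k] by (simp add: m_assoc del: nat_pow_Suc)
  also have "\<dots> = (e x \<otimes> e ?y) \<otimes> e x [^] k"
    using assms y by (simp add: Suc m_assoc)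
  also have "\<dots> = e (x \<triangleright> ?y) \<otimes> (e x \<otimes> e x [^] k)"
    using assms y closed e_swap[of x ?y] by (simp add: m_assoc)
  finally show ?case using assms nat_pow_Suc2[of "e x" k] by simp
qed (use assms in simp)

text \<open>Here the power travels to the left, so \<open>y\<close> is the preimage of
  \<open>x\<close> under the \<open>k\<close>-fold translation by \<open>q\<close>. That the other
  factor stays a single generator is what keeps word lengths under control.\<close>

lemma swap_e_pow:
  assumes "x \<in> Q" "q \<in> Q"
  obtains y where "y \<in> Q" "e x \<otimes> e q [^] (k::nat) = e q [^] k \<otimes> e y"
proof -
  have "\<exists>y\<in>Q. e x \<otimes> e q [^] k = e q [^] k \<otimes> e y"
    using assms
  proof (induction k arbitrary: x)
    case 0
    then show ?case by auto
  next
    case (Suc k)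
    obtain z where z: "z \<in> Q" "q \<triangleright> z = x" using left_div Suc.prems by blast
    obtain y where y: "y \<in> Q" "e z \<otimes> e q [^] k = e q [^] k \<otimes> e y"
      using Suc.IH[OF z(1) Suc.prems(2)] by blast
    have "e x \<otimes> e q [^] Suc k = (e x \<otimes> e q) \<otimes> e q [^] k"
      using Suc.prems nat_pow_Suc2[of "e q" k] by (simp add: m_assoc del: nat_pow_Suc)
    also have "\<dots> = e q \<otimes> (e z \<otimes> e q [^] k)"
      using Suc.prems z e_swap[of q z] by (simp add: m_assoc[symmetric])
    also have "\<dots> = e q [^] Suc k \<otimes> e y"
      using Suc.prems y nat_pow_Suc2[of "e q" k] by (simp add: m_assoc del: nat_pow_Suc)
    finally show ?case using y by blast
  qed
  then show ?thesis using that by blast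
qed

end


section \<open>Central powers of the generators\<close>

locale periodic_quandle_group = quandle_generated_group +
  fixes n :: nat
  assumes finite_Q: "finite Q"
    and n_pos: "n > 0"
    and left_pow_n: "\<lbrakk>x \<in> Q; y \<in> Q\<rbrakk> \<Longrightarrow> (((\<triangleright>) x) ^^ n) y = y"
begin

lemma e_pow_central:
  assumes "x \<in> Q" "g \<in> carrier G"
  shows "e x [^] n \<otimes> g = g \<otimes> e x [^] n"
proof -
  have "g \<otimes> e x [^] n = e x [^] n \<otimes> g"
  proof (rule generate_commute[of "e ` Q"])
    show "e ` Q \<subseteq> carrier G" by (rule image_subsetI) (rule e_closed)
    show "e x [^] n \<in> carrier G" using assms(1) by simp
    show "g \<in> generate G (e ` Q)" using assms(2) by (simp only: generates)
    fix a assume "a \<in> e ` Q"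
    then show "a \<otimes> e x [^] n = e x [^] n \<otimes> a"
      using e_pow_swap[OF assms(1), of _ n] left_pow_n[OF assms(1)] by clarsimp
  qed
  then show ?thesis by simp
qed

text \<open>Conjugation by \<open>e x\<close> turns the \<open>n\<close>-th power of
  \<open>e y\<close> into that of \<open>e (x \<triangleright> y)\<close>, but it also fixes the
  former, which is central.\<close>

lemma e_pow_left:
  assumes x: "x \<in> Q" and y: "y \<in> Q"
  shows "e (x \<triangleright> y) [^] n = e y [^] n"
proof -
  have xy: "x \<triangleright> y \<in> Q" using closed x y by blast
  have "e x \<otimes> e y [^] (k::nat) = e (x \<triangleright> y) [^] k \<otimes> e x" for k
  proof (induction k)
    case (Suc k)
    have "e x \<otimes> e y [^] Suc k = (e x \<otimes> e y [^] k) \<otimes> e y"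
      using x y by (simp add: m_assoc)
    also have "\<dots> = e (x \<triangleright> y) [^] k \<otimes> (e x \<otimes> e y)"
      using x y xy by (simp add: Suc m_assoc)
    also have "\<dots> = e (x \<triangleright> y) [^] Suc k \<otimes> e x"
      using x y xy e_swap[OF x y] by (simp add: m_assoc)
    finally show ?case .
  qed (use x in simp)
  then have "e (x \<triangleright> y) [^] n \<otimes> e x = e y [^] n \<otimes> e x"
    using e_pow_central[OF y, of "e x"] x by simp
  then show ?thesis using x y xy by simp
qed

text \<open>Words without inverse letters are enough for the finiteness proof: if
  \<open>e x [^] n = \<one>\<close>, the inverse of \<open>e x\<close> is its power with exponent
  \<open>n - 1\<close>.\<close>

definition e_prod :: "'a list \<Rightarrow> 'b" where
  "e_prod ws = foldr (\<lambda>x g. e x \<otimes> g) ws \<one>"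

lemma e_prod_simps [simp]:
  "e_prod [] = \<one>"
  "e_prod (x # ws) = e x \<otimes> e_prod ws"
  by (simp_all add: e_prod_def)

lemma e_prod_closed [simp]: "set ws \<subseteq> Q \<Longrightarrow> e_prod ws \<in> carrier G"
  by (induction ws) auto

lemma e_prod_append:
  "\<lbrakk>set ws \<subseteq> Q; set ws' \<subseteq> Q\<rbrakk> \<Longrightarrow> e_prod (ws @ ws') = e_prod ws \<otimes> e_prod ws'"
  by (induction ws) (auto simp: m_assoc)

lemma e_prod_replicate: "x \<in> Q \<Longrightarrow> e_prod (replicate k x) = e x [^] k"
proof (induction k)
  case (Suc k)
  then show ?case using nat_pow_Suc2[of "e x" k] by simp
qed simp

text \<open>Moving every \<open>q\<close> to the front may rewrite the letters passed over, but it
  preserves their number. Cancelling \<open>n\<close> copies of \<open>q\<close> afterwards thus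
  makes the word strictly shorter.\<close>

lemma e_prod_pull:
  assumes "q \<in> Q" "set ws \<subseteq> Q"
  shows "\<exists>ws'. set ws' \<subseteq> Q \<and> length ws' + count_list ws q = length ws \<and>
    e_prod ws = e q [^] count_list ws q \<otimes> e_prod ws'"
  using assms(2)
proof (induction ws)
  case (Cons x ws)
  let ?c = "count_list ws q"
  obtain ws' where ws': "set ws' \<subseteq> Q" "length ws' + ?c = length ws"
    "e_prod ws = e q [^] ?c \<otimes> e_prod ws'"
    using Cons by auto
  show ?case
  proof (cases "x = q")
    case True
    have "e_prod (x # ws) = e q [^] Suc ?c \<otimes> e_prod ws'"
      using True ws' assms(1) nat_pow_Suc2[of "e q" ?c] by (simp add: m_assoc del: nat_pow_Suc)
    then show ?thesis
      using True ws' by (intro exI[of _ ws']) simp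
  next
    case False
    obtain y where y: "y \<in> Q" "e x \<otimes> e q [^] ?c = e q [^] ?c \<otimes> e y"
      using swap_e_pow[of x q ?c] Cons.prems assms(1) by auto
    have "e_prod (x # ws) = (e x \<otimes> e q [^] ?c) \<otimes> e_prod ws'"
      using ws' assms(1) Cons.prems by (simp add: m_assoc)
    also have "\<dots> = e q [^] ?c \<otimes> e_prod (y # ws')"
      using ws' y assms(1) by (simp add: m_assoc)
    finally show ?thesis
      using False ws' y by (intro exI[of _ "y # ws'"]) simp
  qed
qed simp

text \<open>A word of length more than \<open>card Q * n\<close> contains some letter more than \<open>n\<close> times; \<open>n\<close> copies
  of it can be moved to the front, where they cancel.\<close>

lemma finite_carrier:
  assumes torsion: "\<And>x. x \<in> Q \<Longrightarrow> e x [^] n = \<one>"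
  shows "finite (carrier G)"
proof -
  let ?L = "{ws. set ws \<subseteq> Q \<and> length ws \<le> card Q * n}"
  have short: "\<exists>ws'\<in>?L. e_prod ws' = e_prod ws" if "set ws \<subseteq> Q" for ws
    using that
  proof (induction "length ws" arbitrary: ws rule: less_induct)
    case less
    show ?case
    proof (cases "length ws \<le> card Q * n")
      case False
      have "\<exists>q\<in>Q. count_list ws q > n"
      proof (rule ccontr)
        assume "\<not> (\<exists>q\<in>Q. count_list ws q > n)"
        then have "sum (count_list ws) Q \<le> card Q * n"
          using sum_bounded_above[of Q "count_list ws" n] by (auto simp: not_less)
        then show False using sum_count_set[OF less.prems finite_Q] False by simp
      qed
      then obtain q where q: "q \<in> Q" "count_list ws q > n" by blast
      define c where "c = count_list ws q"
      obtain ws' where ws': "set ws' \<subseteq> Q" "length ws' + c = length ws"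
        "e_prod ws = e q [^] c \<otimes> e_prod ws'"
        using e_prod_pull[OF q(1) less.prems] unfolding c_def by blast
      have c: "c = n + (c - n)" using q(2) by (simp add: c_def)
      have "e_prod (replicate (c - n) q @ ws') = e q [^] (c - n) \<otimes> e_prod ws'"
        using q ws' by (subst e_prod_append) (auto simp: e_prod_replicate)
      also have "\<dots> = e_prod ws"
        using q(1) ws'(3) torsion[OF q(1)] nat_pow_mult[of "e q" n "c - n"] c by simp
      finally have eq: "e_prod (replicate (c - n) q @ ws') = e_prod ws" .
      have "length (replicate (c - n) q @ ws') < length ws"
        using ws'(2) c n_pos by simp
      moreover have "set (replicate (c - n) q @ ws') \<subseteq> Q" using q ws' by auto
      ultimately show ?thesis using less.hyps[of "replicate (c - n) q @ ws'"] eq by simp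
    qed (use less.prems in auto)
  qed
  have "\<exists>ws. set ws \<subseteq> Q \<and> e_prod ws = g" if "g \<in> generate G (e ` Q)" for g
    using that
  proof induction
    case one
    show ?case by (intro exI[of _ "[]"]) simp
  next
    case (incl h)
    then obtain x where "x \<in> Q" "h = e x" by auto
    then show ?case by (intro exI[of _ "[x]"]) simp
  next
    case (inv h)
    then obtain x where x: "x \<in> Q" "h = e x" by auto
    have "e x [^] (n - 1) \<otimes> e x = \<one>"
      using torsion[OF x(1)] n_pos nat_pow_Suc[of "e x" "n - 1"] by simp
    then have "inv h = e_prod (replicate (n - 1) x)"
      using x by (simp add: inv_equality e_prod_replicate)
    then show ?case using x by (intro exI[of _ "replicate (n - 1) x"]) auto
  next
    case (eng h1 h2)
    then obtain ws ws' where "set ws \<subseteq> Q" "e_prod ws = h1" "set ws' \<subseteq> Q" "e_prod ws' = h2" by auto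
    then show ?case by (intro exI[of _ "ws @ ws'"]) (simp add: e_prod_append)
  qed
  then have "carrier G \<subseteq> e_prod ` ?L"
    using short generates by (force simp: image_iff)
  moreover have "finite ?L" using finite_lists_length_le[OF finite_Q] .
  ultimately show ?thesis by (meson finite_imageI finite_subset)
qed

text \<open>Only nonnegative exponents occur, because an element of the subgroup generated by the
  central powers will be represented by two such products, one on each side of an equation.\<close>

definition pow_prod :: "'a list \<Rightarrow> 'b" where
  "pow_prod xs = foldr (\<lambda>x g. e x [^] n \<otimes> g) xs \<one>"

lemma pow_prod_simps [simp]:
  "pow_prod [] = \<one>"
  "pow_prod (x # xs) = e x [^] n \<otimes> pow_prod xs"
  by (simp_all add: pow_prod_def)

lemma pow_prod_closed [simp]: "set xs \<subseteq> Q \<Longrightarrow> pow_prod xs \<in> carrier G"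
  by (induction xs) auto

lemma pow_prod_append:
  "\<lbrakk>set xs \<subseteq> Q; set ys \<subseteq> Q\<rbrakk> \<Longrightarrow> pow_prod (xs @ ys) = pow_prod xs \<otimes> pow_prod ys"
  by (induction xs) (auto simp: m_assoc)

lemma pow_prod_central:
  "\<lbrakk>set xs \<subseteq> Q; g \<in> carrier G\<rbrakk> \<Longrightarrow> pow_prod xs \<otimes> g = g \<otimes> pow_prod xs"
proof (induction xs)
  case (Cons x xs)
  then have "pow_prod (x # xs) \<otimes> g = (e x [^] n \<otimes> g) \<otimes> pow_prod xs"
    by (simp add: m_assoc)
  also have "\<dots> = g \<otimes> pow_prod (x # xs)"
    using Cons.prems e_pow_central[of x g] by (simp add: m_assoc)
  finally show ?case .
qed simp

text \<open>The factors commute, so only the multiset of their values matters. Comparing values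
  rather than letters makes letters with the same \<open>n\<close>-th power interchangeable.\<close>

lemma pow_prod_eqI:
  assumes "set xs \<subseteq> Q" "set ys \<subseteq> Q"
    and "mset (map (\<lambda>x. e x [^] n) xs) = mset (map (\<lambda>x. e x [^] n) ys)"
  shows "pow_prod xs = pow_prod ys"
  using assms
proof (induction xs arbitrary: ys)
  case (Cons x xs)
  have "e x [^] n \<in> set (map (\<lambda>x. e x [^] n) ys)"
    using mset_eq_setD[OF Cons.prems(3)] by auto
  then obtain y where "y \<in> set ys" and eq: "e x [^] n = e y [^] n" by auto
  then obtain l r where ys: "ys = l @ y # r" by (meson split_list)
  have "mset (map (\<lambda>x. e x [^] n) xs) = mset (map (\<lambda>x. e x [^] n) (l @ r))"
    using Cons.prems(3) eq by (simp add: ys)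
  then have "pow_prod xs = pow_prod (l @ r)"
    using Cons.prems by (intro Cons.IH) (auto simp: ys)
  then have "pow_prod (x # xs) = (e y [^] n \<otimes> pow_prod l) \<otimes> pow_prod r"
    using Cons.prems eq by (simp add: ys pow_prod_append m_assoc)
  also have "\<dots> = pow_prod l \<otimes> e y [^] n \<otimes> pow_prod r"
    using Cons.prems pow_prod_central[of l "e y [^] n"] by (simp add: ys)
  also have "\<dots> = pow_prod ys"
    using Cons.prems by (simp add: ys pow_prod_append m_assoc)
  finally show ?case .
qed simp

end

section \<open>A finite quotient of the enveloping group\<close>

context quandle
begin

definition conj_rels :: "('q word \<times> 'q word) set" where
  "conj_rels = {([(x, True), (y, True), (x, False)], [(x \<triangleright> y, True)]) | x y. x \<in> Q \<and> y \<in> Q}"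

definition torsion_rels :: "nat \<Rightarrow> ('q word \<times> 'q word) set" where
  "torsion_rels n = {(replicate n (x, True), []) | x. x \<in> Q}"

lemma enveloping_group_conj_rels: "enveloping_group Q (\<triangleright>) = presented_group Q conj_rels"
  by (simp add: enveloping_group_def conj_rels_def)

lemma quandle_generated_presented_group:
  assumes "conj_rels \<subseteq> R"
  shows "quandle_generated_group Q (\<triangleright>) (presented_group Q R) (gen_class Q R)"
proof -
  interpret G: group "presented_group Q R" by (rule group_presented_group)
  have cl: "gen_class Q R x \<in> carrier (presented_group Q R)" if "x \<in> Q" for x
    using that by (intro presented_group_classI) simp
  show ?thesis
  proof unfold_locales
    fix x y assume x: "x \<in> Q" and y: "y \<in> Q"
    have xy: "x \<triangleright> y \<in> Q" using closed x y by blast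
    have "pres_cong Q R [(x, True), (y, True), (x, False)] [(x \<triangleright> y, True)]"
      using assms x y xy by (intro pres_cong.rel) (auto simp: conj_rels_def)
    then have "word_class Q R ([(x, True)] @ [(y, True)] @ [(x, False)]) = gen_class Q R (x \<triangleright> y)"
      by (simp add: presented_group_class_eqI)
    then have "gen_class Q R x \<otimes>\<^bsub>presented_group Q R\<^esub> (gen_class Q R y
        \<otimes>\<^bsub>presented_group Q R\<^esub> inv\<^bsub>presented_group Q R\<^esub> gen_class Q R x) = gen_class Q R (x \<triangleright> y)"
      using word_class_append[of "[(x, True)]" Q "[(y, True), (x, False)]" R]
        word_class_append[of "[(y, True)]" Q "[(x, False)]" R] x y
      by (simp add: word_class_inverse_letter)
    then show "gen_class Q R x \<otimes>\<^bsub>presented_group Q R\<^esub> gen_class Q R y =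
        gen_class Q R (x \<triangleright> y) \<otimes>\<^bsub>presented_group Q R\<^esub> gen_class Q R x"
      using cl x y xy by (metis G.inv_closed G.inv_solve_right' G.m_assoc G.m_closed)
  qed (use cl generate_gen_class in auto)
qed

end

text \<open>An exponent sum in which \<open>f\<close> labels the letters. For labels invariant under
  left translation it is a homomorphism from G(Q) to the integers, kept here on the level of
  words.\<close>

definition signed_count :: "('a \<Rightarrow> 'b) \<Rightarrow> 'b \<Rightarrow> 'a word \<Rightarrow> int" where
  "signed_count f c u = (\<Sum>(x, b)\<leftarrow>u. if f x = c then if b then 1 else - 1 else 0)"

lemma signed_count_simps [simp]:
  "signed_count f c [] = 0"
  "signed_count f c (u @ v) = signed_count f c u + signed_count f c v"
  "signed_count f c ((x, b) # u) = (if f x = c then if b then 1 else - 1 else 0) + signed_count f c u"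
  by (simp_all add: signed_count_def)

text \<open>In a conjugation relation the two occurrences of \<open>x\<close> cancel, while
  \<open>y\<close> and \<open>x \<triangleright> y\<close> carry the same label.\<close>

lemma (in quandle) signed_count_cong:
  assumes "\<And>x y. \<lbrakk>x \<in> Q; y \<in> Q\<rbrakk> \<Longrightarrow> f (x \<triangleright> y) = f y"
  shows "pres_cong Q conj_rels u v \<Longrightarrow> signed_count f c u = signed_count f c v"
  by (induction rule: pres_cong.induct) (auto simp: conj_rels_def assms)

lemma signed_count_concat_replicate:
  "signed_count f c (concat (map (\<lambda>x. replicate n (x, True)) xs)) = int n * int (count (mset (map f xs)) c)"
proof -
  have "signed_count f c (replicate n (x, True)) = (if f x = c then int n else 0)" for x
    by (induction n) auto
  then show ?thesis by (induction xs) (auto simp: algebra_simps)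
qed

text \<open>Let \<open>n\<close> be a period of the left translations. The kernel \<open>N\<close> of the map from \<open>G(Q)\<close> to its quotient by
  the relations \<open>x\<^sup>n = 1\<close> consists of products of central elements \<open>x\<^sup>n\<close>, and \<open>x\<^sup>n\<close> depends only on the
  orbit of \<open>x\<close>. Counting letters by orbit shows that \<open>N\<close> is torsion-free and meets the commutator
  subgroup trivially, so the commutator subgroup survives in the quotient.\<close>

lemma (in quandle) comm_group_enveloping_group:
  assumes fin: "finite Q" and n: "n > 0"
    and period: "\<And>x y. \<lbrakk>x \<in> Q; y \<in> Q\<rbrakk> \<Longrightarrow> (((\<triangleright>) x) ^^ n) y = y"
    and comm: "comm_group (presented_group Q (conj_rels \<union> torsion_rels n))"
  shows "comm_group (enveloping_group Q (\<triangleright>))"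
proof -
  let ?G = "presented_group Q conj_rels" and ?e = "gen_class Q conj_rels"
    and ?R = "conj_rels \<union> torsion_rels n"
  let ?cls = "word_class Q conj_rels"
  interpret G: quandle_generated_group Q "(\<triangleright>)" ?G ?e
    by (rule quandle_generated_presented_group) simp
  interpret G: periodic_quandle_group Q "(\<triangleright>)" ?G ?e n
    by unfold_locales (use fin n period in auto)
  let ?Z = "\<lambda>xs. concat (map (\<lambda>x. replicate n (x, True)) xs)"
  have rep_words: "replicate n (x, True) \<in> words Q" if "x \<in> Q" for x and n
    using that by (induction n) auto
  have Z_words: "?Z xs \<in> words Q" if "set xs \<subseteq> Q" for xs
    using that rep_words by (induction xs) auto
  have cls_Z: "?cls (?Z xs) = G.pow_prod xs" if "set xs \<subseteq> Q" for xs
    using that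
  proof (induction xs)
    case (Cons x xs)
    then show ?case
      using rep_words[of x n] Z_words[of xs]
      by (simp add: word_class_append word_class_replicate del: replicate.simps)
  qed (simp add: one_presented_group)
  have cl: "?cls u \<in> carrier ?G" if "u \<in> words Q" for u
    using that by (rule presented_group_classI)

  \<comment> \<open>Congruence modulo the torsion relations is equality in G(Q) up to central powers
    on both sides. Centrality is what lets these factors be collected at the right in the transitive
    and multiplicative cases.\<close>
  have lift: "\<exists>xs ys. set xs \<subseteq> Q \<and> set ys \<subseteq> Q \<and>
      ?cls u \<otimes>\<^bsub>?G\<^esub> G.pow_prod xs = ?cls v \<otimes>\<^bsub>?G\<^esub> G.pow_prod ys"
    if "pres_cong Q ?R u v" for u v
    using that
  proof induction
    case (rel u v)
    show ?case
    proof (cases "(u, v) \<in> conj_rels")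
      case True
      then have "?cls u = ?cls v"
        using rel by (intro presented_group_class_eqI pres_cong.rel)
      then show ?thesis by (intro exI[of _ "[]"]) simp
    next
      case False
      then obtain x where x: "x \<in> Q" "u = replicate n (x, True)" "v = []"
        using rel by (auto simp: torsion_rels_def)
      then show ?thesis
        by (intro exI[of _ "[]"] exI[of _ "[x]"])
          (simp add: word_class_replicate one_presented_group[symmetric])
    qed
  next
    case (cancel x b)
    then have "?cls [(x, b), (x, \<not> b)] = ?cls []"
      by (intro presented_group_class_eqI pres_cong.cancel)
    then show ?case by (intro exI[of _ "[]"]) simp
  next
    case (refl u)
    show ?case by (intro exI[of _ "[]"]) simp
  next
    case (sym u v)
    then show ?case by metis
  next
    case (trans u v w)
    from trans.IH obtain xs ys xs' ys' where *: "set xs \<subseteq> Q" "set ys \<subseteq> Q" "set xs' \<subseteq> Q" "set ys' \<subseteq> Q"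
      "?cls u \<otimes>\<^bsub>?G\<^esub> G.pow_prod xs = ?cls v \<otimes>\<^bsub>?G\<^esub> G.pow_prod ys"
      "?cls v \<otimes>\<^bsub>?G\<^esub> G.pow_prod xs' = ?cls w \<otimes>\<^bsub>?G\<^esub> G.pow_prod ys'" by blast
    have c: "?cls u \<in> carrier ?G" "?cls v \<in> carrier ?G" "?cls w \<in> carrier ?G"
      using trans.hyps[THEN pres_cong_words] cl by auto
    have "?cls u \<otimes>\<^bsub>?G\<^esub> G.pow_prod (xs @ xs') = ?cls v \<otimes>\<^bsub>?G\<^esub> (G.pow_prod ys \<otimes>\<^bsub>?G\<^esub> G.pow_prod xs')"
      using * c by (simp add: G.pow_prod_append G.m_assoc[symmetric])
    also have "G.pow_prod ys \<otimes>\<^bsub>?G\<^esub> G.pow_prod xs' = G.pow_prod xs' \<otimes>\<^bsub>?G\<^esub> G.pow_prod ys"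
      using * by (intro G.pow_prod_central) simp_all
    also have "?cls v \<otimes>\<^bsub>?G\<^esub> (G.pow_prod xs' \<otimes>\<^bsub>?G\<^esub> G.pow_prod ys) = ?cls w \<otimes>\<^bsub>?G\<^esub> G.pow_prod (ys' @ ys)"
      using * c by (simp add: G.pow_prod_append G.m_assoc[symmetric])
    finally show ?case using * by (intro exI[of _ "xs @ xs'"] exI[of _ "ys' @ ys"]) simp
  next
    case (mult u u' v v')
    from mult.IH obtain xs ys xs' ys' where *: "set xs \<subseteq> Q" "set ys \<subseteq> Q" "set xs' \<subseteq> Q" "set ys' \<subseteq> Q"
      "?cls u \<otimes>\<^bsub>?G\<^esub> G.pow_prod xs = ?cls u' \<otimes>\<^bsub>?G\<^esub> G.pow_prod ys"
      "?cls v \<otimes>\<^bsub>?G\<^esub> G.pow_prod xs' = ?cls v' \<otimes>\<^bsub>?G\<^esub> G.pow_prod ys'" by blast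
    have w: "u \<in> words Q" "u' \<in> words Q" "v \<in> words Q" "v' \<in> words Q"
      using mult.hyps[THEN pres_cong_words] by auto
    have split: "?cls (u @ v) \<otimes>\<^bsub>?G\<^esub> G.pow_prod (xs @ xs') =
        (?cls u \<otimes>\<^bsub>?G\<^esub> G.pow_prod xs) \<otimes>\<^bsub>?G\<^esub> (?cls v \<otimes>\<^bsub>?G\<^esub> G.pow_prod xs')"
      if "u \<in> words Q" "v \<in> words Q" "set xs \<subseteq> Q" "set xs' \<subseteq> Q" for u v xs xs'
    proof -
      have "?cls (u @ v) \<otimes>\<^bsub>?G\<^esub> G.pow_prod (xs @ xs') =
          ?cls u \<otimes>\<^bsub>?G\<^esub> (?cls v \<otimes>\<^bsub>?G\<^esub> G.pow_prod xs) \<otimes>\<^bsub>?G\<^esub> G.pow_prod xs'"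
        using that cl by (simp add: word_class_append G.pow_prod_append G.m_assoc)
      also have "?cls v \<otimes>\<^bsub>?G\<^esub> G.pow_prod xs = G.pow_prod xs \<otimes>\<^bsub>?G\<^esub> ?cls v"
        using that cl G.pow_prod_central[of xs "?cls v"] by simp
      finally show ?thesis using that cl by (simp add: G.m_assoc)
    qed
    have "?cls (u @ v) \<otimes>\<^bsub>?G\<^esub> G.pow_prod (xs @ xs') = ?cls (u' @ v') \<otimes>\<^bsub>?G\<^esub> G.pow_prod (ys @ ys')"
      using w * by (simp only: split)
    then show ?case using * by (intro exI[of _ "xs @ xs'"] exI[of _ "ys @ ys'"]) simp
  qed

  have "?e x \<otimes>\<^bsub>?G\<^esub> ?e y = ?e y \<otimes>\<^bsub>?G\<^esub> ?e x" if x: "x \<in> Q" and y: "y \<in> Q" for x y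
  proof -
    let ?z = "\<lambda>x. ?e x [^]\<^bsub>?G\<^esub> n"
    let ?u = "[(x, True), (y, True)]" and ?v = "[(y, True), (x, True)]"
    have w: "?u \<in> words Q" "?v \<in> words Q" using x y by auto
    have uv: "?cls ?u = ?e x \<otimes>\<^bsub>?G\<^esub> ?e y" "?cls ?v = ?e y \<otimes>\<^bsub>?G\<^esub> ?e x"
      using word_class_append[of "[(x, True)]" Q "[(y, True)]" conj_rels]
        word_class_append[of "[(y, True)]" Q "[(x, True)]" conj_rels] x y by auto
    have "word_class Q ?R ?u = word_class Q ?R ?v"
      using word_class_append[of "[(x, True)]" Q "[(y, True)]" ?R]
        word_class_append[of "[(y, True)]" Q "[(x, True)]" ?R] x y
        comm_groupE(4)[OF comm presented_group_classI presented_group_classI] by simp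
    then have "pres_cong Q ?R ?u ?v" by (simp only: word_class_eq_iff[OF w])
    then obtain xs ys where *: "set xs \<subseteq> Q" "set ys \<subseteq> Q"
      "?cls ?u \<otimes>\<^bsub>?G\<^esub> G.pow_prod xs = ?cls ?v \<otimes>\<^bsub>?G\<^esub> G.pow_prod ys"
      using lift by blast
    have "?cls (?u @ ?Z xs) = ?cls (?v @ ?Z ys)"
      using * w Z_words by (simp only: word_class_append cls_Z)
    then have cong: "pres_cong Q conj_rels (?u @ ?Z xs) (?v @ ?Z ys)"
      using * w Z_words by (subst (asm) word_class_eq_iff) auto
    \<comment> \<open>Letters are labelled by their \<open>n\<close>-th powers, a label invariant by
      \<open>e_pow_left\<close>. The words \<open>?u\<close> and \<open>?v\<close> have the same
      letters and contribute equally, so \<open>n > 0\<close> can be cancelled, and the remaining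
      counts are those required by \<open>pow_prod_eqI\<close>.\<close>
    have "count (mset (map ?z xs)) c = count (mset (map ?z ys)) c" for c
    proof -
      have "signed_count ?z c (?u @ ?Z xs) = signed_count ?z c (?v @ ?Z ys)"
        by (rule signed_count_cong[OF _ cong]) (rule G.e_pow_left)
      then show ?thesis
        using n by (simp add: signed_count_concat_replicate del: mset_map)
    qed
    then have "G.pow_prod xs = G.pow_prod ys"
      using * by (intro G.pow_prod_eqI multiset_eqI)
    then show ?thesis using * w uv cl by (metis G.pow_prod_closed G.right_cancel)
  qed
  then have "comm_group ?G"
    by (intro G.comm_group_generate[OF G.generates]) auto
  then show ?thesis by (simp only: enveloping_group_conj_rels)
qed

section \<open>Irreducible representations of commuting operators\<close>

lemma (in vectorspace) lin_indpt_in_finite_span: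
  assumes "finite B" "B \<subseteq> carrier V" "lin_indpt A" "A \<subseteq> span B"
  shows "finite A"
proof (rule ccontr)
  assume "infinite A"
  then obtain A' where A': "A' \<subseteq> A" "finite A'" "card A' = Suc (card B)"
    by (metis infinite_arbitrarily_large)
  have "lin_indpt A'" using subset_li_is_li[OF assms(3) A'(1)] .
  moreover have "A' \<subseteq> span B" using A'(1) assms(4) by blast
  ultimately obtain C where "C \<subseteq> carrier V" "int (card C) \<le> int (card B) - int (card A')"
    using replacement[OF A'(2) assms(1,2)] by blast
  then show False using A'(3) by simp
qed

text \<open>A countable set has countably many finite subsets. Their spans cover
  \<open>span S\<close>, and each of them contains only finitely many elements of
  \<open>A\<close>.\<close>

lemma (in vectorspace) countable_lin_indpt:
  assumes "countable S" "S \<subseteq> carrier V" "lin_indpt A" "A \<subseteq> span S"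
  shows "countable A"
proof -
  let ?F = "{B. B \<subseteq> S \<and> finite B}"
  have "A \<subseteq> (\<Union>B\<in>?F. A \<inter> span B)"
  proof
    fix x assume x: "x \<in> A"
    then obtain a B where "x = lincomb a B" "finite B" "B \<subseteq> S" "a \<in> B \<rightarrow> carrier K"
      using assms(4) unfolding span_def by blast
    then show "x \<in> (\<Union>B\<in>?F. A \<inter> span B)" using x unfolding span_def by blast
  qed
  moreover have "countable (A \<inter> span B)" if "B \<in> ?F" for B
  proof (rule countable_finite, rule lin_indpt_in_finite_span)
    show "lin_indpt (A \<inter> span B)" by (rule subset_li_is_li[OF assms(3)]) blast
    show "B \<subseteq> carrier V" using that assms(2) by blast
  qed (use that in simp_all)
  then have "countable (\<Union>B\<in>?F. A \<inter> span B)"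
    using countable_Collect_finite_subset[OF assms(1)]
    by (intro countable_UN) (simp_all only: conj_commute)
  ultimately show ?thesis by (rule countable_subset)
qed

locale complex_vectorspace = vectorspace complex_field V for V (structure)
begin

lemma smult_add_left: "v \<in> carrier V \<Longrightarrow> (a + b) \<odot> v = a \<odot> v \<oplus> b \<odot> v"
  using smult_l_distr[of a b v] by simp

lemma smult_mult: "v \<in> carrier V \<Longrightarrow> (a * b) \<odot> v = a \<odot> (b \<odot> v)"
  using smult_assoc1[of a b v] by simp

lemma smult_add_right: "\<lbrakk>v \<in> carrier V; w \<in> carrier V\<rbrakk> \<Longrightarrow> a \<odot> (v \<oplus> w) = a \<odot> v \<oplus> a \<odot> w"
  using smult_r_distr[of a v w] by simp

lemma smult_in_carrier [simp]: "v \<in> carrier V \<Longrightarrow> a \<odot> v \<in> carrier V"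
  by simp

lemma smult_zero_left: "v \<in> carrier V \<Longrightarrow> 0 \<odot> v = \<zero>"
  using smult_l_null[of v] by simp

lemma smult_one_left: "v \<in> carrier V \<Longrightarrow> 1 \<odot> v = v"
  using smult_one[of v] by simp

lemma smult_minus: "v \<in> carrier V \<Longrightarrow> (- a) \<odot> v = \<ominus> (a \<odot> v)"
  using smult_add_left[of v "- a" a] by (intro minus_equality[symmetric]) (auto simp: smult_zero_left)

lemma smult_eq_zero:
  assumes "v \<in> carrier V" "a \<odot> v = \<zero>" "a \<noteq> 0"
  shows "v = \<zero>"
proof -
  have "v = (inverse a * a) \<odot> v" using assms by (simp add: smult_one_left)
  also have "\<dots> = \<zero>" using assms smult_r_null[of "inverse a"] by (simp only: smult_mult) simp
  finally show ?thesis .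
qed

lemma subspaceI:
  assumes "W \<subseteq> carrier V" "\<zero> \<in> W"
    and "\<And>v w. \<lbrakk>v \<in> W; w \<in> W\<rbrakk> \<Longrightarrow> v \<oplus> w \<in> W"
    and "\<And>a v. v \<in> W \<Longrightarrow> a \<odot> v \<in> W"
  shows "VectorSpace.subspace complex_field W V"
  using assms by unfold_locales auto

end

section \<open>Polynomials in a single operator\<close>

locale complex_operator = complex_vectorspace +
  fixes T
  assumes T_closed [simp]: "v \<in> carrier V \<Longrightarrow> T v \<in> carrier V"
    and T_add: "\<lbrakk>v \<in> carrier V; w \<in> carrier V\<rbrakk> \<Longrightarrow> T (v \<oplus> w) = T v \<oplus> T w"
    and T_smult: "v \<in> carrier V \<Longrightarrow> T (a \<odot> v) = a \<odot> T v"
begin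

lemma T_zero [simp]: "T \<zero> = \<zero>"
  using T_smult[of \<zero> 0] by (simp add: smult_zero_left)

text \<open>The vector p(T) v, evaluated by Horner's scheme.\<close>

definition poly_act :: "complex poly \<Rightarrow> 'a \<Rightarrow> 'a" where
  "poly_act p v = fold_coeffs (\<lambda>a w. a \<odot> v \<oplus> T w) p \<zero>"

text \<open>The operator T - c, arranged like the coefficients of \<open>[:- c, 1:]\<close>.\<close>

definition shift :: "complex \<Rightarrow> 'a \<Rightarrow> 'a" where
  "shift c v = (- c) \<odot> v \<oplus> T v"

lemma poly_act_0 [simp]: "poly_act 0 v = \<zero>"
  by (simp add: poly_act_def)

lemma poly_act_pCons:
  "v \<in> carrier V \<Longrightarrow> poly_act (pCons a p) v = a \<odot> v \<oplus> T (poly_act p v)"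
  by (cases "p = 0"; cases "a = 0") (simp_all add: poly_act_def smult_zero_left)

lemma poly_act_closed [simp]: "v \<in> carrier V \<Longrightarrow> poly_act p v \<in> carrier V"
  by (induction p) (simp_all add: poly_act_pCons)

lemma poly_act_const: "v \<in> carrier V \<Longrightarrow> poly_act [:a:] v = a \<odot> v"
  by (simp add: poly_act_pCons)

lemma poly_act_add:
  "v \<in> carrier V \<Longrightarrow> poly_act (p + q) v = poly_act p v \<oplus> poly_act q v"
  by (induction p q rule: poly_induct2)
    (simp_all add: poly_act_pCons smult_add_left T_add a_ac)

lemma poly_act_smult:
  "v \<in> carrier V \<Longrightarrow> poly_act (Polynomial.smult c p) v = c \<odot> poly_act p v"
  using smult_r_null[of c]
  by (induction p) (simp_all add: poly_act_pCons smult_mult T_smult smult_add_right)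

lemma shift_closed [simp]: "v \<in> carrier V \<Longrightarrow> shift c v \<in> carrier V"
  by (simp add: shift_def)

lemma shift_add:
  "\<lbrakk>v \<in> carrier V; w \<in> carrier V\<rbrakk> \<Longrightarrow> shift c (v \<oplus> w) = shift c v \<oplus> shift c w"
  by (simp add: shift_def smult_add_right T_add a_ac)

lemma shift_smult: "v \<in> carrier V \<Longrightarrow> shift c (a \<odot> v) = a \<odot> shift c v"
  by (simp add: shift_def smult_add_right T_smult smult_mult[symmetric] mult.commute)

lemma poly_act_linear_factor:
  assumes "v \<in> carrier V"
  shows "poly_act ([:- c, 1:] * p) v = shift c (poly_act p v)"
proof -
  have "[:- c, 1:] * p = Polynomial.smult (- c) p + pCons 0 p" by simp
  then show ?thesis
    using assms by (simp only: poly_act_add poly_act_smult poly_act_pCons shift_def)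
      (simp add: smult_zero_left)
qed

lemma poly_act_vec_add:
  "\<lbrakk>v \<in> carrier V; w \<in> carrier V\<rbrakk> \<Longrightarrow> poly_act p (v \<oplus> w) = poly_act p v \<oplus> poly_act p w"
  by (induction p) (simp_all add: poly_act_pCons smult_add_right T_add a_ac)

lemma poly_act_vec_smult:
  "v \<in> carrier V \<Longrightarrow> poly_act p (a \<odot> v) = a \<odot> poly_act p v"
  using smult_r_null[of a]
  by (induction p)
    (simp_all add: poly_act_pCons smult_add_right T_smult smult_mult[symmetric] mult.commute)

lemma poly_act_T: "v \<in> carrier V \<Longrightarrow> poly_act p (T v) = T (poly_act p v)"
  by (induction p) (simp_all add: poly_act_pCons T_add T_smult)

lemma poly_act_shift:
  "v \<in> carrier V \<Longrightarrow> poly_act p (shift c v) = shift c (poly_act p v)"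
  by (simp add: shift_def poly_act_vec_add poly_act_vec_smult poly_act_T)

text \<open>A nonconstant polynomial splits off a linear factor over the complex numbers, and the
  injective operator T - c can be cancelled. What remains in the end is a constant, and a nonzero
  constant annihilates no nonzero vector.\<close>

lemma poly_act_eq_zero:
  assumes inj: "\<And>c w. \<lbrakk>w \<in> carrier V; shift c w = \<zero>\<rbrakk> \<Longrightarrow> w = \<zero>"
    and v: "v \<in> carrier V" "v \<noteq> \<zero>"
  shows "poly_act p v = \<zero> \<Longrightarrow> p = 0"
proof (induction "degree p" arbitrary: p)
  case 0
  then obtain a where p: "p = [:a:]" by (metis degree_eq_zeroE)
  then show ?case using 0 v smult_eq_zero[of v a] by (auto simp: poly_act_const)
next
  case (Suc d)
  have "\<not> constant (poly p)" using Suc.hyps(2) by (simp add: constant_degree)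
  then obtain c where "poly p c = 0" using fundamental_theorem_of_algebra by blast
  then obtain q where q: "p = [:- c, 1:] * q" by (metis dvdE poly_eq_0_iff_dvd)
  then have "q \<noteq> 0" using Suc.hyps(2) by auto
  then have "degree q = d"
    using Suc.hyps(2) degree_mult_eq[of "[:- c, 1:]" q] unfolding q by simp
  moreover have "poly_act q v = \<zero>"
  proof (rule inj[of _ c])
    show "shift c (poly_act q v) = \<zero>"
      using Suc.prems unfolding q poly_act_linear_factor[OF v(1)] .
    show "poly_act q v \<in> carrier V" using v(1) by (rule poly_act_closed)
  qed
  ultimately show ?case using Suc.hyps(1)[of q] \<open>q \<noteq> 0\<close> by simp
qed

text \<open>Partial fractions: clearing denominators in a linear relation between the \<open>(T - c)\<^sup>-\<^sup>1 v\<close> gives a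
  polynomial \<open>p\<close> with \<open>p(T) v = 0\<close>, and \<open>p = 0\<close> only if the relation is trivial.\<close>

lemma lin_indpt_resolvents:
  assumes inj: "\<And>c w. \<lbrakk>w \<in> carrier V; shift c w = \<zero>\<rbrakk> \<Longrightarrow> w = \<zero>"
    and v: "v \<in> carrier V" "v \<noteq> \<zero>"
    and u: "\<And>c. u c \<in> carrier V" "\<And>c. shift c (u c) = v"
  shows "lin_indpt (range u)"
proof
  assume "lin_dep (range u)"
  then obtain A a b where A: "finite A" "A \<subseteq> range u" "lincomb a A = \<zero>" and b: "b \<in> A" "a b \<noteq> 0"
    unfolding lin_dep_def by auto
  \<comment> \<open>\<open>q\<close> is the common denominator and \<open>p\<close> the numerator.
    The clause on the roots of \<open>q\<close> makes the induction work: the next pole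
    \<open>c\<close> is not among them, so if the new numerator vanishes, its value
    \<open>a b * poly q c\<close> at \<open>c\<close> forces \<open>a b = 0\<close>.\<close>
  have "\<exists>p q. q \<noteq> 0 \<and> (\<forall>c. poly q c = 0 \<longrightarrow> u c \<in> A) \<and> (p = 0 \<longrightarrow> (\<forall>b\<in>A. a b = 0)) \<and>
    poly_act q (lincomb a A) = poly_act p v"
    using A(1,2)
  proof (induction A rule: finite_induct)
    case empty
    show ?case by (intro exI[of _ 0] exI[of _ 1]) (simp add: lincomb_def one_pCons poly_act_const
          smult_one_left)
  next
    case (insert b A)
    from insert obtain p q where pq: "q \<noteq> 0" "\<And>c. poly q c = 0 \<Longrightarrow> u c \<in> A"
      "p = 0 \<Longrightarrow> \<forall>b\<in>A. a b = 0" "poly_act q (lincomb a A) = poly_act p v" by auto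
    obtain c where c: "b = u c" using insert.prems by auto
    have AV: "A \<subseteq> carrier V" "b \<in> carrier V" using insert.prems u by auto
    then have lV: "lincomb a A \<in> carrier V" by (intro lincomb_closed) auto
    let ?q = "[:- c, 1:] * q" and ?p = "Polynomial.smult (a b) q + [:- c, 1:] * p"
    have "lincomb a (insert b A) = a b \<odot> b \<oplus> lincomb a A"
      using insert.hyps AV by (intro lincomb_insert2) auto
    then have "poly_act ?q (lincomb a (insert b A)) =
        a b \<odot> poly_act ?q b \<oplus> poly_act ?q (lincomb a A)"
      using AV lV by (simp only: poly_act_vec_add poly_act_vec_smult smult_in_carrier)
    also have "poly_act ?q b = poly_act q v"
      using AV u by (simp only: poly_act_linear_factor poly_act_shift[symmetric] c)
    also have "poly_act ?q (lincomb a A) = poly_act ([:- c, 1:] * p) v"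
      using lV v pq(4) by (simp only: poly_act_linear_factor)
    also have "a b \<odot> poly_act q v \<oplus> poly_act ([:- c, 1:] * p) v = poly_act ?p v"
      using v by (simp only: poly_act_add poly_act_smult)
    finally have eq: "poly_act ?q (lincomb a (insert b A)) = poly_act ?p v" .
    have zero: "\<forall>d\<in>insert b A. a d = 0" if "?p = 0"
    proof -
      have "poly q c \<noteq> 0" using pq(2) c insert.hyps by blast
      moreover have "a b * poly q c = 0" using arg_cong[OF that, of "\<lambda>p. poly p c"] by simp
      ultimately have "a b = 0" by simp
      moreover from this have "[:- c, 1:] * p = 0"
        using that by (simp only: smult_0_left add_0_left)
      then have "p = 0" by (simp only: mult_eq_0_iff) simp
      ultimately show ?thesis using pq(3) by simp
    qed
    have "?q \<noteq> 0" using pq(1) by (simp only: mult_eq_0_iff) simp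
    moreover have "\<forall>d. poly ?q d = 0 \<longrightarrow> u d \<in> insert b A" using pq(2) c by auto
    ultimately show ?case using eq zero by blast
  qed
  then obtain p q where "p = 0 \<longrightarrow> (\<forall>b\<in>A. a b = 0)" "poly_act q (lincomb a A) = poly_act p v" by blast
  moreover have "poly_act q \<zero> = \<zero>"
    using poly_act_vec_smult[of \<zero> q 0] by (simp add: smult_zero_left)
  ultimately have "poly_act p v = \<zero>" using A(3) by simp
  with inj v have "p = 0" by (rule poly_act_eq_zero)
  then show False using \<open>p = 0 \<longrightarrow> _\<close> b by blast
qed

text \<open>If every T - c were invertible, the resolvents applied to \<open>v\<close> would form an
  uncountable independent set in a space with a countable spanning set.\<close>

lemma exists_noninvertible_shift:
  assumes "countable S" "S \<subseteq> carrier V" "span S = carrier V" "v \<in> carrier V" "v \<noteq> \<zero>"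
  obtains c where "\<not> bij_betw (shift c) (carrier V) (carrier V)"
proof -
  have False if bij: "\<And>c. bij_betw (shift c) (carrier V) (carrier V)"
  proof -
    have shift0: "shift c \<zero> = \<zero>" for c
      using shift_smult[of \<zero> c 0] by (simp add: smult_zero_left)
    have inj: "w = \<zero>" if "w \<in> carrier V" "shift c w = \<zero>" for c w
      using bij[of c] that shift0[of c] by (metis bij_betw_imp_inj_on inj_onD zero_closed)
    have "\<exists>w\<in>carrier V. shift c w = v" for c
      using bij[of c] assms(4) unfolding bij_betw_def by (metis imageE)
    then obtain u where u: "\<And>c. u c \<in> carrier V" "\<And>c. shift c (u c) = v" by metis
    \<comment> \<open>Independence concerns the set \<open>range u\<close>; injectivity is needed to
      know that this set is uncountable. If two resolvents agree at \<open>v\<close>, then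
      \<open>(d - c) \<odot> u c\<close> is zero, while \<open>u c\<close> is not.\<close>
    have inj_u: "inj u"
    proof (rule injI)
      fix c d assume "u c = u d"
      then have "shift c (u c) = shift d (u c)" using u(2) by metis
      then have "(- c) \<odot> u c = (- d) \<odot> u c"
        using u(1) by (simp add: shift_def)
      then have "(- c) \<odot> u c \<oplus> d \<odot> u c = \<zero>"
        using u(1)[of c] smult_add_left[of "u c" "- d" d] by (simp add: smult_zero_left)
      then have "(d - c) \<odot> u c = \<zero>"
        using u(1)[of c] smult_add_left[of "u c" "- c" d] by simp
      moreover have "u c \<noteq> \<zero>" using u(2)[of c] shift0 assms(5) by metis
      ultimately show "c = d" using smult_eq_zero[of "u c" "d - c"] u(1) by auto
    qed
    have "range u \<subseteq> span S" using u(1) assms(3) by blast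
    moreover have "lin_indpt (range u)"
      using inj u by (intro lin_indpt_resolvents[OF _ assms(4,5)]) auto
    ultimately have "countable (range u)"
      by (intro countable_lin_indpt[OF assms(1,2)])
    then show False
      using uncountable_UNIV_complex inj_u countable_image_inj_on by blast
  qed
  then show ?thesis using that by blast
qed

lemma shift_zero [simp]: "shift c \<zero> = \<zero>"
  using shift_smult[of \<zero> c 0] by (simp add: smult_zero_left)

text \<open>Schur's lemma: kernel and image of \<open>T - c\<close> are stable.\<close>

lemma scalar_if_commutes_with_irreducible:
  assumes irr: "\<And>W. \<lbrakk>VectorSpace.subspace complex_field W V; \<And>f. f \<in> F \<Longrightarrow> f ` W \<subseteq> W\<rbrakk> \<Longrightarrow> W = {\<zero>} \<or> W = carrier V"
    and F: "\<And>f. f \<in> F \<Longrightarrow> complex_operator V f"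
    and comm: "\<And>f v. \<lbrakk>f \<in> F; v \<in> carrier V\<rbrakk> \<Longrightarrow> f (T v) = T (f v)"
    and not_bij: "\<not> bij_betw (shift c) (carrier V) (carrier V)"
    and w: "w \<in> carrier V"
  shows "T w = c \<odot> w"
proof -
  have shift_comm: "f (shift c v) = shift c (f v)" and f_closed: "f v \<in> carrier V" and f_zero: "f \<zero> = \<zero>"
    if "f \<in> F" "v \<in> carrier V" for f v
  proof -
    interpret f: complex_operator V f by (rule F[OF that(1)])
    show "f (shift c v) = shift c (f v)" "f v \<in> carrier V" "f \<zero> = \<zero>"
      using that comm by (simp_all add: shift_def f.T_add f.T_smult)
  qed
  let ?ker = "{v \<in> carrier V. shift c v = \<zero>}"
  have "VectorSpace.subspace complex_field ?ker V"
    using smult_r_null by (intro subspaceI) (auto simp: shift_add shift_smult)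
  moreover have "f ` ?ker \<subseteq> ?ker" if "f \<in> F" for f
    using that f_closed f_zero shift_comm by (auto simp flip: shift_comm)
  ultimately have ker: "?ker = {\<zero>} \<or> ?ker = carrier V" by (rule irr)
  have "VectorSpace.subspace complex_field (shift c ` carrier V) V"
  proof (rule subspaceI)
    show "\<zero> \<in> shift c ` carrier V" by (rule image_eqI[of _ _ "\<zero>"]) simp_all
    show "v \<oplus> w \<in> shift c ` carrier V" if "v \<in> shift c ` carrier V" "w \<in> shift c ` carrier V" for v w
      using that by (auto simp flip: shift_add)
    show "a \<odot> v \<in> shift c ` carrier V" if "v \<in> shift c ` carrier V" for a v
      using that by (auto simp flip: shift_smult)
  qed auto
  moreover have "f ` shift c ` carrier V \<subseteq> shift c ` carrier V" if "f \<in> F" for f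
    using that f_closed by (auto simp: shift_comm)
  ultimately have im: "shift c ` carrier V = {\<zero>} \<or> shift c ` carrier V = carrier V" by (rule irr)
  have "shift c w = \<zero>"
  proof (cases "?ker = carrier V")
    case False
    have "inj_on (shift c) (carrier V)"
    proof (rule inj_onI)
      fix x y assume xy: "x \<in> carrier V" "y \<in> carrier V" "shift c x = shift c y"
      have "shift c (x \<oplus> (- 1) \<odot> y) = shift c x \<oplus> (- 1) \<odot> shift c y"
        using xy by (simp add: shift_add shift_smult)
      also have "\<dots> = \<zero>"
        using xy by (simp add: smult_minus smult_one_left r_neg)
      finally have "shift c (x \<oplus> (- 1) \<odot> y) = \<zero>" .
      moreover have "x \<oplus> (- 1) \<odot> y \<in> carrier V" using xy by simp
      ultimately have "x \<oplus> (- 1) \<odot> y = \<zero>" using ker False by blast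
      then have "x \<oplus> \<ominus> y = \<zero>" using xy by (simp add: smult_minus smult_one_left)
      then show "x = y" using xy minus_equality[of x "\<ominus> y"] by simp
    qed
    then have "shift c ` carrier V = {\<zero>}" using im not_bij unfolding bij_betw_def by blast
    then show ?thesis using w by blast
  qed (use w in blast)
  then have "c \<odot> w = c \<odot> w \<oplus> ((- c) \<odot> w \<oplus> T w)" using w by (simp add: shift_def)
  also have "\<dots> = T w"
    using w by (simp add: a_assoc[symmetric] smult_add_left[symmetric] smult_zero_left)
  finally show ?thesis by simp
qed

end

section \<open>From commuting operators to dimension one\<close>

lemma carrier_GL:
  "f \<in> carrier (GL K V) \<longleftrightarrow> f \<in> LinearCombinations.module_hom K V V \<and> f \<in> Bij (carrier V)"
  by (simp add: GL_def)

lemma mult_GL: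
  assumes "f \<in> carrier (GL K V)" "g \<in> carrier (GL K V)"
  shows "f \<otimes>\<^bsub>GL K V\<^esub> g = compose (carrier V) f g"
  using assms by (simp add: GL_def BijGroup_def)

lemma complex_operator_GL:
  assumes "vectorspace complex_field V" "f \<in> carrier (GL complex_field V)"
  shows "complex_operator V f"
proof -
  interpret complex_vectorspace V by (intro complex_vectorspace.intro assms(1))
  have "f \<in> LinearCombinations.module_hom complex_field V V" using assms(2) by (simp add: carrier_GL)
  then show ?thesis
    by unfold_locales (auto simp: LinearCombinations.module_hom_def)
qed

lemma has_dim_1_if_commuting:
  assumes irr: "irreducible_quandle_rep Q qop complex_field V \<rho>" and "countable Q"
    and comm: "\<And>x y v. \<lbrakk>x \<in> Q; y \<in> Q; v \<in> carrier V\<rbrakk> \<Longrightarrow> \<rho> x (\<rho> y v) = \<rho> y (\<rho> x v)"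
  shows "has_dim complex_field V 1"
proof -
  have vs: "vectorspace complex_field V" and GL: "\<And>x. x \<in> Q \<Longrightarrow> \<rho> x \<in> carrier (GL complex_field V)"
    using irr by (auto simp: irreducible_quandle_rep_def quandle_rep_def)
  interpret complex_vectorspace V by (intro complex_vectorspace.intro vs)
  have op: "complex_operator V (\<rho> x)" if "x \<in> Q" for x
    using complex_operator_GL[OF vs GL[OF that]] .
  note closed = complex_operator.T_closed[OF op]
  have irr_subspace: "W = {\<zero>\<^bsub>V\<^esub>} \<or> W = carrier V"
    if "VectorSpace.subspace complex_field W V" "\<And>x. x \<in> Q \<Longrightarrow> \<rho> x ` W \<subseteq> W" for W
    using irr that by (auto simp: irreducible_quandle_rep_def)
  obtain v where v: "v \<in> carrier V" "v \<noteq> \<zero>\<^bsub>V\<^esub>"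
    using irr by (auto simp: irreducible_quandle_rep_def)
  \<comment> \<open>The orbit of \<open>v\<close> under all products of the operators. It is
    countable because \<open>Q\<close> is, and its span is stable and nonzero, hence the whole
    space.\<close>
  define S where "S = (\<lambda>ws. foldr \<rho> ws v) ` lists Q"
  have S: "S \<subseteq> carrier V"
  proof -
    have "foldr \<rho> ws v \<in> carrier V" if "ws \<in> lists Q" for ws
      using that v(1) closed by (induction ws) auto
    then show ?thesis by (auto simp: S_def)
  qed
  have "v \<in> S" unfolding S_def by (rule image_eqI[of _ _ "[]"]) auto
  then have vS: "v \<in> span S" using in_own_span[OF S] by blast
  have stable: "\<rho> x ` span S \<subseteq> span S" if x: "x \<in> Q" for x
  proof -
    interpret T: complex_operator V "\<rho> x" by (rule op[OF x])
    have sub: "submodule complex_field (span S) V" by (rule span_is_submodule[OF S])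
    let ?W = "{w \<in> carrier V. \<rho> x w \<in> span S}"
    have "submodule complex_field ?W V"
    proof (rule is_module, rule subspaceI)
      show "\<zero>\<^bsub>V\<^esub> \<in> ?W" using submodule.zero_closed[OF sub] by simp
      show "w \<oplus>\<^bsub>V\<^esub> w' \<in> ?W" if "w \<in> ?W" "w' \<in> ?W" for w w'
        using that submodule.m_closed[OF sub] by (simp add: T.T_add)
      show "a \<odot>\<^bsub>V\<^esub> w \<in> ?W" if "w \<in> ?W" for a w
        using that submodule.smult_closed[OF sub] by (simp add: T.T_smult)
    qed auto
    moreover have "S \<subseteq> ?W"
    proof
      fix s assume s: "s \<in> S"
      then obtain ws where ws: "ws \<in> lists Q" "s = foldr \<rho> ws v" by (auto simp: S_def)
      then have "\<rho> x s \<in> S" unfolding S_def using x by (intro image_eqI[of _ _ "x # ws"]) auto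
      then show "s \<in> ?W" using s S in_own_span[OF S] by blast
    qed
    ultimately have "span S \<subseteq> ?W" by (intro span_is_subset)
    then show ?thesis by blast
  qed
  have "span S = carrier V"
    using irr_subspace[OF span_is_subspace[OF S] stable] vS v(2) by blast
  moreover have "countable S" using assms(2) by (simp add: S_def)
  ultimately have scalar: "\<exists>c. \<forall>w\<in>carrier V. \<rho> x w = c \<odot>\<^bsub>V\<^esub> w" if x: "x \<in> Q" for x
  proof -
    interpret T: complex_operator V "\<rho> x" by (rule op[OF x])
    obtain c where c: "\<not> bij_betw (T.shift c) (carrier V) (carrier V)"
      using T.exists_noninvertible_shift[OF \<open>countable S\<close> S \<open>span S = carrier V\<close> v] .
    have "\<rho> x w = c \<odot>\<^bsub>V\<^esub> w" if "w \<in> carrier V" for w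
      by (rule T.scalar_if_commutes_with_irreducible[of "\<rho> ` Q"])
        (use irr_subspace op comm x c that in auto)
    then show ?thesis by blast
  qed
  \<comment> \<open>Scalars stabilize every line, so irreducibility makes the line through
    \<open>v\<close> the whole space.\<close>
  have v1: "{v} \<subseteq> carrier V" using v by simp
  have "\<rho> x ` span {v} \<subseteq> span {v}" if x: "x \<in> Q" for x
  proof -
    obtain c where c: "\<And>w. w \<in> carrier V \<Longrightarrow> \<rho> x w = c \<odot>\<^bsub>V\<^esub> w" using scalar[OF x] by blast
    then show ?thesis
      using span_is_subset2[OF v1] submodule.smult_closed[OF span_is_submodule[OF v1], of c] by auto
  qed
  then have "span {v} = {\<zero>\<^bsub>V\<^esub>} \<or> span {v} = carrier V"
    by (intro irr_subspace span_is_subspace v1)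
  then have gen: "span {v} = carrier V" using in_own_span[OF v1] v(2) by blast
  then have "fin_dim" using v1 unfolding fin_dim_def by (intro exI[of _ "{v}"]) simp
  moreover have "dim = 1" using dim1I[OF gen v(2,1)] .
  ultimately show ?thesis by (simp add: has_dim_def)
qed

section \<open>Extending quandle representations to the enveloping group\<close>

definition (in group) word_eval :: "('x \<Rightarrow> 'a) \<Rightarrow> 'x word \<Rightarrow> 'a" where
  "word_eval f u = foldr (\<lambda>(x, b) g. (if b then f x else inv f x) \<otimes> g) u \<one>"

lemma (in group) word_eval_simps [simp]:
  "word_eval f [] = \<one>"
  "word_eval f ((x, b) # u) = (if b then f x else inv f x) \<otimes> word_eval f u"
  by (simp_all add: word_eval_def)

lemma (in group) word_eval_closed [simp]:
  "\<lbrakk>f \<in> S \<rightarrow> carrier G; u \<in> words S\<rbrakk> \<Longrightarrow> word_eval f u \<in> carrier G"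
  by (induction u) (auto simp: Pi_iff)

lemma (in group) word_eval_append:
  "\<lbrakk>f \<in> S \<rightarrow> carrier G; u \<in> words S; v \<in> words S\<rbrakk> \<Longrightarrow>
    word_eval f (u @ v) = word_eval f u \<otimes> word_eval f v"
  by (induction u) (auto simp: m_assoc Pi_iff)

text \<open>The universal property of a presentation, on the level of words: an assignment of the
  generators that respects the relations respects the whole congruence.\<close>

lemma (in group) word_eval_cong:
  assumes f: "f \<in> S \<rightarrow> carrier G"
    and R: "\<And>u v. (u, v) \<in> R \<Longrightarrow> word_eval f u = word_eval f v"
  shows "pres_cong S R u v \<Longrightarrow> word_eval f u = word_eval f v"
proof (induction rule: pres_cong.induct)
  case (cancel x b)
  then have "f x \<in> carrier G" using f by auto
  then show ?case by simp
next
  case (mult u u' v v')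
  then show ?case using pres_cong_words f by (metis word_eval_append)
qed (use R in auto)

text \<open>The operators of a quandle representation satisfy the defining relations of G(Q), so
  every equality between words there, in particular commutation of generators, holds for them
  too.\<close>

lemma quandle_rep_commute:
  assumes rep: "quandle_rep Q qop K V \<rho>" and comm: "comm_group (enveloping_group Q qop)"
    and x: "x \<in> Q" and y: "y \<in> Q"
  shows "\<rho> x \<otimes>\<^bsub>GL K V\<^esub> \<rho> y = \<rho> y \<otimes>\<^bsub>GL K V\<^esub> \<rho> x"
proof -
  let ?R = "{([(x, True), (y, True), (x, False)], [(qop x y, True)]) | x y. x \<in> Q \<and> y \<in> Q}"
  interpret vectorspace K V using rep by (simp add: quandle_rep_def)
  interpret GL: group "GL K V" by (intro group_GL module_axioms)
  have \<rho>: "\<rho> \<in> Q \<rightarrow> carrier (GL K V)" using rep by (simp add: quandle_rep_def)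
  have "GL.word_eval \<rho> u = GL.word_eval \<rho> v" if uv: "(u, v) \<in> ?R" for u v
  proof -
    obtain a b where ab: "u = [(a, True), (b, True), (a, False)]" "v = [(qop a b, True)]" "a \<in> Q" "b \<in> Q"
      using uv by auto
    moreover have "\<rho> a \<in> carrier (GL K V)" "\<rho> b \<in> carrier (GL K V)" using \<rho> ab by auto
    moreover have "\<rho> (qop a b) = \<rho> a \<otimes>\<^bsub>GL K V\<^esub> \<rho> b \<otimes>\<^bsub>GL K V\<^esub> inv\<^bsub>GL K V\<^esub> \<rho> a"
      using rep ab by (simp add: quandle_rep_def)
    ultimately show ?thesis by (simp add: GL.m_assoc)
  qed
  then have cong: "pres_cong Q ?R u v \<Longrightarrow> GL.word_eval \<rho> u = GL.word_eval \<rho> v" for u v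
    using GL.word_eval_cong[OF \<rho>, of ?R u v] by blast
  have w: "[(x, True)] \<in> words Q" "[(y, True)] \<in> words Q" "[(x, True), (y, True)] \<in> words Q"
    "[(y, True), (x, True)] \<in> words Q"
    using x y by auto
  have "word_class Q ?R [(x, True), (y, True)] = word_class Q ?R [(y, True), (x, True)]"
    using comm_groupE(4)[OF comm, of "gen_class Q ?R x" "gen_class Q ?R y"]
      presented_group_classI[OF w(1), of ?R] presented_group_classI[OF w(2), of ?R]
    by (simp add: enveloping_group_def presented_group_mult_class[OF w(1,2)] presented_group_mult_class[OF w(2,1)])
  then have "pres_cong Q ?R [(x, True), (y, True)] [(y, True), (x, True)]"
    by (simp only: word_class_eq_iff[OF w(3,4)])
  from cong[OF this] show ?thesis using x y \<rho> by (simp add: Pi_iff)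
qed

lemma has_dim_1_if_comm_group:
  assumes "irreducible_quandle_rep Q qop complex_field V \<rho>" "countable Q"
    and "comm_group (enveloping_group Q qop)"
  shows "has_dim complex_field V 1"
proof (rule has_dim_1_if_commuting[OF assms(1,2)])
  fix x y v assume x: "x \<in> Q" and y: "y \<in> Q" and v: "v \<in> carrier V"
  have rep: "quandle_rep Q qop complex_field V \<rho>"
    using assms(1) by (simp add: irreducible_quandle_rep_def)
  then have "\<rho> x \<in> carrier (GL complex_field V)" "\<rho> y \<in> carrier (GL complex_field V)"
    using x y by (auto simp: quandle_rep_def)
  then have "compose (carrier V) (\<rho> x) (\<rho> y) = compose (carrier V) (\<rho> y) (\<rho> x)"
    using quandle_rep_commute[OF rep assms(3) x y] by (simp add: mult_GL)
  from fun_cong[OF this, of v] show "\<rho> x (\<rho> y v) = \<rho> y (\<rho> x v)"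
    using v by (simp add: compose_def)
qed

section \<open>Irreducible spaces of functions on a finite group\<close>

text \<open>Functions are total; requiring the value 0 off \<open>X\<close> makes equality of
  functions the same as equality on \<open>X\<close>.\<close>

definition function_subspace :: "'g set \<Rightarrow> ('g \<Rightarrow> complex) set \<Rightarrow> bool" where
  "function_subspace X W \<longleftrightarrow>
    (\<lambda>_. 0) \<in> W \<and>
    (\<forall>f\<in>W. \<forall>g\<in>W. (\<lambda>x. f x + g x) \<in> W) \<and>
    (\<forall>f\<in>W. \<forall>c. (\<lambda>x. c * f x) \<in> W) \<and>
    (\<forall>f\<in>W. \<forall>x. x \<notin> X \<longrightarrow> f x = 0)"

lemma function_subspace_zero: "function_subspace X W \<Longrightarrow> (\<lambda>_. 0) \<in> W"
  and function_subspace_add: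
    "\<lbrakk>function_subspace X W; f \<in> W; g \<in> W\<rbrakk> \<Longrightarrow> (\<lambda>x. f x + g x) \<in> W"
  and function_subspace_scale: "\<lbrakk>function_subspace X W; f \<in> W\<rbrakk> \<Longrightarrow> (\<lambda>x. c * f x) \<in> W"
  and function_subspace_support: "\<lbrakk>function_subspace X W; f \<in> W; x \<notin> X\<rbrakk> \<Longrightarrow> f x = 0"
  by (auto simp: function_subspace_def)

text \<open>Each point of \<open>X\<close> contributes one complex coordinate, and C x C is
  equipotent to C. This is the bound that moves function spaces into \<open>'v\<close>.\<close>

lemma complex_functions_lepoll:
  assumes "finite X"
  shows "{f :: 'a \<Rightarrow> complex. \<forall>x. x \<notin> X \<longrightarrow> f x = 0} \<lesssim> (UNIV :: complex set)"
  using assms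
proof induction
  case empty
  show ?case
    unfolding lepoll_def by (intro exI[of _ "\<lambda>_. 0"]) (auto intro!: inj_onI ext)
next
  case (insert a X)
  let ?B = "\<lambda>X. {f :: 'a \<Rightarrow> complex. \<forall>x. x \<notin> X \<longrightarrow> f x = 0}"
  have "?B (insert a X) \<lesssim> (UNIV :: complex set) \<times> ?B X"
    unfolding lepoll_def
  proof (intro exI conjI)
    show "inj_on (\<lambda>f. (f a, f(a := 0))) (?B (insert a X))"
      by (rule inj_onI) (metis fun_upd_idem fun_upd_upd prod.inject)
    show "(\<lambda>f. (f a, f(a := 0))) ` ?B (insert a X) \<subseteq> UNIV \<times> ?B X" by auto
  qed
  also have "\<dots> \<lesssim> (UNIV :: complex set) \<times> (UNIV :: complex set)"
    by (rule times_lepoll_mono[OF lepoll_refl insert.IH])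
  also have "\<dots> \<approx> (UNIV :: complex set)"
    using card_of_Times_same_infinite[of "UNIV :: complex set"] infinite_UNIV_char_0
    by (simp add: eqpoll_iff_card_of_ordIso del: UNIV_Times_UNIV)
  finally show ?case .
qed

text \<open>The minimum is taken over the number of pivots, the positions of leading nonzero entries
  with respect to an enumeration \<open>h\<close> of \<open>X\<close>.\<close>

lemma exists_minimal_function_subspace:
  assumes fin: "finite X" and P: "\<And>W. P W \<Longrightarrow> function_subspace X W" and "P U"
  obtains W where "P W" "\<And>W'. \<lbrakk>P W'; W' \<subseteq> W\<rbrakk> \<Longrightarrow> W' = W"
proof -
  obtain h :: "'a \<Rightarrow> nat" where inj: "inj_on h X"
    using finite_imp_inj_to_nat_seg[OF fin] by blast
  define pivots where
    "pivots W = {x \<in> X. \<exists>f\<in>W. f x \<noteq> 0 \<and> (\<forall>y\<in>X. h y < h x \<longrightarrow> f y = 0)}" for W :: "('a \<Rightarrow> complex) set"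
  obtain W where W: "P W" "\<And>W'. P W' \<Longrightarrow> card (pivots W) \<le> card (pivots W')"
    using ex_has_least_nat[of P U "\<lambda>W. card (pivots W)"] \<open>P U\<close> by blast
  have "W' = W" if W': "P W'" "W' \<subseteq> W" for W'
  proof -
    note subs = P[OF W(1)] P[OF W'(1)]
    have "pivots W' = pivots W"
    proof (rule card_seteq)
      show "finite (pivots W)" using fin by (simp add: pivots_def)
      show "pivots W' \<subseteq> pivots W" using W'(2) unfolding pivots_def by blast
    qed (rule W(2)[OF W'(1)])
    have "f \<in> W'" if f: "f \<in> W" for f
    proof -
      have approx: "\<exists>g\<in>W'. \<forall>y\<in>X. h y < k \<longrightarrow> f y = g y" for k
      proof (induction k)
        case 0
        show ?case using function_subspace_zero[OF subs(2)] by auto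
      next
        case (Suc k)
        then obtain g where g: "g \<in> W'" "\<And>y. \<lbrakk>y \<in> X; h y < k\<rbrakk> \<Longrightarrow> f y = g y" by blast
        show ?case
        proof (cases "\<exists>x\<in>X. h x = k \<and> f x \<noteq> g x")
          case True
          then obtain x where x: "x \<in> X" "h x = k" "f x \<noteq> g x" by blast
          \<comment> \<open>Gaussian elimination: the difference of \<open>f\<close> and
            \<open>g\<close> first fails to vanish at \<open>x\<close>, so \<open>x\<close> is a
            pivot of \<open>W\<close> and hence of \<open>W'\<close>. A multiple of a function in
            \<open>W'\<close> with that pivot corrects \<open>g\<close> at \<open>x\<close> and
            leaves all earlier positions alone.\<close>
          have "(\<lambda>y. f y + (- 1) * g y) \<in> W"
            using f g(1) W'(2) by (intro function_subspace_add[OF subs(1)] function_subspace_scale[OF subs(1)]) auto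
          then have "x \<in> pivots W"
            unfolding pivots_def using x g(2) by (intro CollectI conjI bexI) simp_all
          then have "x \<in> pivots W'" by (simp only: \<open>pivots W' = pivots W\<close>)
          then obtain p where p: "p \<in> W'" "p x \<noteq> 0" "\<And>y. \<lbrakk>y \<in> X; h y < k\<rbrakk> \<Longrightarrow> p y = 0"
            unfolding pivots_def x(2)[symmetric] by blast
          let ?g = "\<lambda>y. g y + (f x - g x) / p x * p y"
          have "?g \<in> W'"
            by (intro function_subspace_add[OF subs(2)] function_subspace_scale[OF subs(2)] g p)
          moreover have "f y = ?g y" if y: "y \<in> X" "h y < Suc k" for y
          proof (cases "h y = k")
            case True
            then have "y = x" using inj x y by (auto dest: inj_onD)
            then show ?thesis using p(2) by simp
          next
            case False
            then have "h y < k" using y(2) by simp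
            then show ?thesis using y(1) g(2) p(3) by simp
          qed
          ultimately show ?thesis by (intro bexI[of _ ?g] ballI impI)
        next
          case False
          then show ?thesis using g by (auto simp: less_Suc_eq)
        qed
      qed
      obtain g where g: "g \<in> W'" "\<And>y. \<lbrakk>y \<in> X; h y < Suc (Max (h ` X))\<rbrakk> \<Longrightarrow> f y = g y"
        using approx by blast
      have "f y = g y" for y
        using g function_subspace_support[OF subs(1) f] function_subspace_support[OF subs(2) g(1)] fin
        by (cases "y \<in> X") (auto simp: less_Suc_eq_le)
      then have "f = g" by blast
      then show ?thesis using g(1) by simp
    qed
    then show ?thesis using W'(2) by blast
  qed
  then show ?thesis using that W(1) by blast
qed

section \<open>The left regular representation\<close>

context group
begin

definition translate :: "'a \<Rightarrow> ('a \<Rightarrow> complex) \<Rightarrow> 'a \<Rightarrow> complex" where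
  "translate a f = (\<lambda>g. if g \<in> carrier G then f (inv a \<otimes> g) else 0)"

lemma translate_mult:
  "\<lbrakk>a \<in> carrier G; b \<in> carrier G\<rbrakk> \<Longrightarrow> translate (a \<otimes> b) f = translate a (translate b f)"
  by (auto simp: translate_def inv_mult_group m_assoc)

lemma translate_one: "(\<And>x. x \<notin> carrier G \<Longrightarrow> f x = 0) \<Longrightarrow> translate \<one> f = f"
  by (auto simp: translate_def)

lemma translate_inv:
  assumes "a \<in> carrier G" "\<And>x. x \<notin> carrier G \<Longrightarrow> f x = 0"
  shows "translate (inv a) (translate a f) = f" "translate a (translate (inv a) f) = f"
  using assms by (simp_all add: translate_mult[symmetric] translate_one)

lemma translate_add: "translate a (\<lambda>x. f x + g x) = (\<lambda>x. translate a f x + translate a g x)"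
  and translate_scale: "translate a (\<lambda>x. c * f x) = (\<lambda>x. c * translate a f x)"
  by (auto simp: translate_def)

text \<open>In a finite group inverses are powers, so stability under generators already gives
  stability under their inverses.\<close>

lemma translate_stable_carrier:
  assumes fin: "finite (carrier G)" and gen: "generate G E = carrier G"
    and W: "\<And>f x. \<lbrakk>f \<in> W; x \<notin> carrier G\<rbrakk> \<Longrightarrow> f x = 0"
    and E: "\<And>a. a \<in> E \<Longrightarrow> translate a ` W \<subseteq> W"
    and a: "a \<in> carrier G"
  shows "translate a ` W \<subseteq> W"
proof -
  have EG: "E \<subseteq> carrier G" using gen generate.incl[of _ E G] by auto
  have one: "translate \<one> ` W \<subseteq> W" using W translate_one by fastforce
  have "a \<in> generate G E" using a gen by simp
  then show ?thesis
  proof induction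
    case one
    show ?case by (rule \<open>translate \<one> ` W \<subseteq> W\<close>)
  next
    case (incl h)
    then show ?case by (rule E)
  next
    case (inv h)
    then have h: "h \<in> carrier G" using EG by auto
    have "translate (h [^] k) ` W \<subseteq> W" for k :: nat
    proof (induction k)
      case (Suc k)
      show ?case
        using Suc E[OF inv] h by (force simp: translate_mult)
    qed (use one in simp)
    moreover have "h [^] (Coset.order G - 1) \<otimes> h = \<one>"
      using pow_order_eq_1[OF h] order_gt_0_iff_finite fin nat_pow_Suc[of h "Coset.order G - 1"] by simp
    then have "inv h = h [^] (Coset.order G - 1)" using h by (simp add: inv_equality)
    ultimately show ?case by simp
  next
    case (eng h1 h2)
    then have "h1 \<in> carrier G" "h2 \<in> carrier G" using gen by auto
    then show ?case using eng.IH by (force simp: translate_mult)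
  qed
qed

text \<open>Functions whose sums over the left cosets of the subgroup generated by a nontrivial commutator
  \<open>c\<close> vanish. A common eigenvector of all translations is invariant under right multiplication
  by \<open>c\<close>, so it is not among them.\<close>

lemma exists_irreducible_function_subspace:
  assumes fin: "finite (carrier G)" and gen: "generate G E = carrier G" and "\<not> comm_group G"
  obtains W where "function_subspace (carrier G) W" "W \<noteq> {\<lambda>_. 0}"
    "\<And>a. a \<in> E \<Longrightarrow> translate a ` W \<subseteq> W"
    "\<And>W'. \<lbrakk>function_subspace (carrier G) W'; W' \<subseteq> W; \<And>a. a \<in> E \<Longrightarrow> translate a ` W' \<subseteq> W'\<rbrakk>
      \<Longrightarrow> W' = {\<lambda>_. 0} \<or> W' = W"
    "\<not> (\<exists>w\<in>W. \<forall>f\<in>W. \<exists>k. f = (\<lambda>x. k * w x))"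
proof -
  obtain x y where xy: "x \<in> carrier G" "y \<in> carrier G" "x \<otimes> y \<noteq> y \<otimes> x"
    using assms(3) group_comm_groupI by blast
  define c where "c = inv (x \<otimes> y) \<otimes> (y \<otimes> x)"
  have c: "c \<in> carrier G" using xy by (simp add: c_def)
  have c1: "c \<noteq> \<one>"
  proof
    assume "c = \<one>"
    then have "(x \<otimes> y) \<otimes> c = x \<otimes> y" using xy by simp
    then show False using xy inv_solve_left' unfolding c_def by (simp add: m_assoc[symmetric])
  qed
  \<comment> \<open>\<open>m\<close> is the order of the group rather than of \<open>c\<close>. The
    sum over \<open>i < m\<close> meets each element of a left coset equally often, so it vanishes
    exactly when the coset sum does, and the power of \<open>c\<close> with exponent
    \<open>m\<close> is the identity.\<close>
  define m where "m = Coset.order G"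
  have m: "m > 0" using fin by (simp add: m_def order_gt_0_iff_finite)
  define U where "U = {f. (\<forall>x. x \<notin> carrier G \<longrightarrow> f x = 0) \<and>
    (\<forall>g\<in>carrier G. (\<Sum>i<m. f (g \<otimes> c [^] i)) = (0 :: complex))}"
  have U: "function_subspace (carrier G) U"
    by (auto simp: function_subspace_def U_def sum.distrib sum_distrib_left[symmetric])
  have U_stable: "translate a ` U \<subseteq> U" if "a \<in> E" for a
  proof -
    have a: "a \<in> carrier G" using that gen generate.incl[of a E G] by auto
    have "(\<Sum>i<m. translate a f (g \<otimes> c [^] i)) = (\<Sum>i<m. f ((inv a \<otimes> g) \<otimes> c [^] i))"
      if "g \<in> carrier G" for f g
      using that a c by (intro sum.cong) (auto simp: translate_def m_assoc)
    then show ?thesis using a by (auto simp: U_def) (simp add: translate_def)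
  qed
  \<comment> \<open>The difference of the indicators of \<open>\<one>\<close> and \<open>c\<close>.
    These are distinct points of the same left coset, so every coset sum is 0.\<close>
  let ?f = "\<lambda>z. (if z = \<one> then 1 else 0) - (if z = c then 1 else 0) :: complex"
  have "?f \<in> U"
  proof -
    have "(\<Sum>i<m. ?f (g \<otimes> c [^] i)) = 0" if g: "g \<in> carrier G" for g
    proof -
      define s where "s i = (if g \<otimes> c [^] (i :: nat) = c then 1 else 0 :: complex)" for i
      \<comment> \<open>Along the sequence \<open>g \<otimes> c [^] i\<close> the two indicators are
        one step apart, so the sum telescopes; it closes up after \<open>m\<close> steps.\<close>
      have "g \<otimes> c [^] i = \<one> \<longleftrightarrow> g \<otimes> c [^] Suc i = c" for i :: nat
        using g c r_cancel_one'[of "g \<otimes> c [^] i" c] by (simp add: m_assoc[symmetric])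
      then have "(\<Sum>i<m. ?f (g \<otimes> c [^] i)) = (\<Sum>i<m. s (Suc i) - s i)"
        by (simp only: s_def)
      also have "\<dots> = s m - s 0" by (rule sum_lessThan_telescope)
      also have "\<dots> = 0" using pow_order_eq_1[OF c] by (simp add: s_def m_def)
      finally show ?thesis .
    qed
    then show ?thesis using c by (auto simp: U_def)
  qed
  moreover have "?f \<noteq> (\<lambda>_. 0)"
    using c1 by (auto dest: fun_cong[of _ _ \<one>])
  ultimately have "U \<noteq> {\<lambda>_. 0}" by blast
  let ?P = "\<lambda>W. function_subspace (carrier G) W \<and> (\<forall>a\<in>E. translate a ` W \<subseteq> W) \<and> W \<subseteq> U \<and> W \<noteq> {\<lambda>_. 0}"
  obtain W where W: "?P W" "\<And>W'. \<lbrakk>?P W'; W' \<subseteq> W\<rbrakk> \<Longrightarrow> W' = W"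
    by (rule exists_minimal_function_subspace[OF fin, of ?P U]) (use U U_stable \<open>U \<noteq> _\<close> in auto)
  have "\<not> (\<exists>w\<in>W. \<forall>f\<in>W. \<exists>k. f = (\<lambda>x. k * w x))"
  proof
    assume "\<exists>w\<in>W. \<forall>f\<in>W. \<exists>k. f = (\<lambda>x. k * w x)"
    then obtain w where w: "w \<in> W" and span: "\<And>f. f \<in> W \<Longrightarrow> \<exists>k. f = (\<lambda>x. k * w x)" by blast
    have "translate a ` W \<subseteq> W" if "a \<in> carrier G" for a
    proof (rule translate_stable_carrier[OF fin gen _ _ that])
      show "f x = 0" if "f \<in> W" "x \<notin> carrier G" for f x
        using function_subspace_support that W(1) by metis
      show "translate b ` W \<subseteq> W" if "b \<in> E" for b using W(1) that by simp
    qed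
    then have "translate a w \<in> W" if "a \<in> carrier G" for a
      using w that by blast
    then have "\<exists>k. translate a w = (\<lambda>x. k * w x)" if "a \<in> carrier G" for a
      using span that by blast
    then obtain \<mu> where \<mu>: "\<And>a. a \<in> carrier G \<Longrightarrow> translate a w = (\<lambda>x. \<mu> a * w x)" by metis
    have \<mu>_mult: "translate (a \<otimes> b) w = (\<lambda>z. \<mu> b * (\<mu> a * w z))"
      if "a \<in> carrier G" "b \<in> carrier G" for a b
      by (simp only: translate_mult[OF that] \<mu>[OF that(2)] translate_scale \<mu>[OF that(1)])
    \<comment> \<open>On the line through \<open>w\<close> translations act by scalars, so those by
      \<open>x \<otimes> y\<close> and \<open>y \<otimes> x\<close> agree. Evaluated at
      \<open>y \<otimes> x\<close>, they give \<open>w c\<close> and \<open>w \<one>\<close>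
      respectively, because
      \<open>c = inv (x \<otimes> y) \<otimes> (y \<otimes> x)\<close>.\<close>
    have "translate (x \<otimes> y) w = translate (y \<otimes> x) w"
      using xy by (simp only: \<mu>_mult mult.left_commute)
    from fun_cong[OF this, of "y \<otimes> x"] have w_c: "w c = w \<one>"
      using xy by (simp add: translate_def c_def)
    \<comment> \<open>The eigenvector equation carries the equality at \<open>\<one>\<close> over to
      all \<open>g\<close>. Then \<open>w\<close> is constant on each left coset, and a vanishing
      sum of \<open>m > 0\<close> equal terms forces it to be 0.\<close>
    have w_mult: "w (g \<otimes> h) = \<mu> (inv g) * w h" if "g \<in> carrier G" "h \<in> carrier G" for g h
      using fun_cong[OF \<mu>[of "inv g"], of h] that by (simp add: translate_def)
    have w_pow: "w (g \<otimes> c [^] i) = w g" if g: "g \<in> carrier G" for g and i :: nat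
    proof (induction i)
      case (Suc i)
      have "w (g \<otimes> c [^] Suc i) = w ((g \<otimes> c [^] i) \<otimes> c)" using g c by (simp add: m_assoc)
      also have "\<dots> = w ((g \<otimes> c [^] i) \<otimes> \<one>)"
        using g c w_c by (simp only: w_mult nat_pow_closed m_closed one_closed)
      finally show ?case using Suc g c by simp
    qed (use g in simp)
    have "w g = 0" for g
    proof (cases "g \<in> carrier G")
      case True
      have "(\<Sum>i<m. w (g \<otimes> c [^] i)) = 0" using w W(1) True by (auto simp: U_def)
      then show ?thesis using m by (simp add: w_pow True)
    next
      case False
      then show ?thesis using function_subspace_support[OF _ w False] W(1) by blast
    qed
    then have "f = (\<lambda>_. 0)" if "f \<in> W" for f using span[OF that] by auto
    then have "W = {\<lambda>_. 0}" using w by blast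
    then show False using W(1) by blast
  qed
  moreover have "W' = {\<lambda>_. 0} \<or> W' = W"
    if "function_subspace (carrier G) W'" "W' \<subseteq> W" "\<And>a. a \<in> E \<Longrightarrow> translate a ` W' \<subseteq> W'" for W'
  proof (cases "W' = {\<lambda>_. 0}")
    case False
    then have "?P W'" using that W(1) by (simp add: subset_trans[of W' W U])
    then show ?thesis using W(2) that(2) by simp
  qed simp
  ultimately show ?thesis using that[of W] W(1) by blast
qed

end

text \<open>The vector space structure of \<open>W\<close> is carried along the injection
  \<open>i\<close> to a subset of \<open>'v\<close>. The second conclusion translates dimension one
  back into a statement about functions, where it can be refuted.\<close>

lemma function_subspace_rep:
  fixes i :: "('g \<Rightarrow> complex) \<Rightarrow> 'v" and T :: "'q \<Rightarrow> ('g \<Rightarrow> complex) \<Rightarrow> 'g \<Rightarrow> complex"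
  assumes W: "function_subspace X W" "W \<noteq> {\<lambda>_. 0}" and inj: "inj_on i W"
    and qop: "\<And>x y. \<lbrakk>x \<in> Q; y \<in> Q\<rbrakk> \<Longrightarrow> qop x y \<in> Q"
    and bij: "\<And>x. x \<in> Q \<Longrightarrow> bij_betw (T x) W W"
    and add: "\<And>x f g. \<lbrakk>x \<in> Q; f \<in> W; g \<in> W\<rbrakk> \<Longrightarrow> T x (\<lambda>z. f z + g z) = (\<lambda>z. T x f z + T x g z)"
    and scale: "\<And>x c f. \<lbrakk>x \<in> Q; f \<in> W\<rbrakk> \<Longrightarrow> T x (\<lambda>z. c * f z) = (\<lambda>z. c * T x f z)"
    and rel: "\<And>x y f. \<lbrakk>x \<in> Q; y \<in> Q; f \<in> W\<rbrakk> \<Longrightarrow> T (qop x y) (T x f) = T x (T y f)"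
    and irr: "\<And>W'. \<lbrakk>function_subspace X W'; W' \<subseteq> W; \<And>x. x \<in> Q \<Longrightarrow> T x ` W' \<subseteq> W'\<rbrakk>
      \<Longrightarrow> W' = {\<lambda>_. 0} \<or> W' = W"
  obtains V :: "(complex, 'v) module" and \<rho> where
    "irreducible_quandle_rep Q qop complex_field V \<rho>"
    "has_dim complex_field V 1 \<Longrightarrow> \<exists>w\<in>W. \<forall>f\<in>W. \<exists>k. f = (\<lambda>x. k * w x)"
proof -
  define j where "j = inv_into W i"
  have j: "j v \<in> W" "i (j v) = v" if "v \<in> i ` W" for v
    using that by (auto simp: j_def inv_into_into f_inv_into_f)
  have ji [simp]: "j (i f) = f" if "f \<in> W" for f
    using that inj by (simp add: j_def)
  note W_zero = function_subspace_zero[OF W(1)] and W_add = function_subspace_add[OF W(1)]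
    and W_scale = function_subspace_scale[OF W(1)]
  have T_closed: "T x f \<in> W" if "x \<in> Q" "f \<in> W" for x f
    using bij that by (auto dest: bij_betwE)
  define V :: "(complex, 'v) module" where "V = \<lparr>carrier = i ` W, monoid.mult = undefined, one = undefined,
    zero = i (\<lambda>_. 0), add = (\<lambda>v w. i (\<lambda>x. j v x + j w x)), module.smult = (\<lambda>c v. i (\<lambda>x. c * j v x))\<rparr>"
  have V: "carrier V = i ` W" "\<zero>\<^bsub>V\<^esub> = i (\<lambda>_. 0)"
    "\<And>f g. \<lbrakk>f \<in> W; g \<in> W\<rbrakk> \<Longrightarrow> i f \<oplus>\<^bsub>V\<^esub> i g = i (\<lambda>x. f x + g x)"
    "\<And>c f. f \<in> W \<Longrightarrow> c \<odot>\<^bsub>V\<^esub> i f = i (\<lambda>x. c * f x)"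
    by (simp_all add: V_def)
  have "Module.module complex_field V"
  proof (rule module_criteria)
    show "cring complex_field" by (rule class_cring.cring_axioms)
    show "\<forall>v\<in>carrier V. \<exists>w\<in>carrier V. v \<oplus>\<^bsub>V\<^esub> w = \<zero>\<^bsub>V\<^esub>"
    proof
      fix v assume "v \<in> carrier V"
      then obtain f where f: "f \<in> W" "v = i f" by (auto simp: V)
      then show "\<exists>w\<in>carrier V. v \<oplus>\<^bsub>V\<^esub> w = \<zero>\<^bsub>V\<^esub>"
        using W_scale[of f "- 1"] by (intro bexI[of _ "i (\<lambda>x. - 1 * f x)"]) (simp_all add: V)
    qed
  qed (auto simp: V W_zero W_add W_scale algebra_simps)
  then have vs: "vectorspace complex_field V"
    by (intro vectorspace.intro class_field)
  interpret complex_vectorspace V by (intro complex_vectorspace.intro vs)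
  interpret GL: group "GL complex_field V" by (intro group_GL module_axioms)
  define \<rho> where "\<rho> x = (\<lambda>v\<in>carrier V. i (T x (j v)))" for x
  have \<rho>: "\<rho> x (i f) = i (T x f)" if "f \<in> W" for x f
    using that by (simp add: \<rho>_def V)
  have \<rho>_GL: "\<rho> x \<in> carrier (GL complex_field V)" if x: "x \<in> Q" for x
  proof -
    have bij_i: "bij_betw i W (i ` W)" using inj by (rule inj_on_imp_bij_betw)
    then have bij_j: "bij_betw j (i ` W) W" unfolding j_def by (rule bij_betw_inv_into)
    have "bij_betw (i \<circ> (T x \<circ> j)) (carrier V) (carrier V)"
      unfolding V using bij_j bij[OF x] bij_i by (intro bij_betw_trans)
    then have "bij_betw (\<rho> x) (carrier V) (carrier V)"
      by (rule bij_betw_cong[THEN iffD1, rotated]) (simp add: \<rho>_def)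
    moreover have "\<rho> x \<in> extensional (carrier V)" by (simp add: \<rho>_def)
    ultimately show ?thesis
      using x by (auto simp: carrier_GL Bij_def LinearCombinations.module_hom_def V \<rho> T_closed
          W_add W_scale add scale)
  qed
  have "quandle_rep Q qop complex_field V \<rho>"
    unfolding quandle_rep_def
  proof (intro conjI vs ballI)
    show "\<rho> \<in> Q \<rightarrow> carrier (GL complex_field V)" using \<rho>_GL by blast
    fix x y assume x: "x \<in> Q" and y: "y \<in> Q"
    note xy = qop[OF x y]
    have "\<rho> (qop x y) \<otimes>\<^bsub>GL complex_field V\<^esub> \<rho> x = \<rho> x \<otimes>\<^bsub>GL complex_field V\<^esub> \<rho> y"
      using \<rho>_GL x y xy
      by (auto simp: mult_GL compose_def V \<rho> T_closed rel intro!: restrict_ext)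
    then show "\<rho> (qop x y) = \<rho> x \<otimes>\<^bsub>GL complex_field V\<^esub> \<rho> y \<otimes>\<^bsub>GL complex_field V\<^esub> inv\<^bsub>GL complex_field V\<^esub> \<rho> x"
      using GL.inv_solve_right \<rho>_GL x y xy by simp
  qed
  moreover have "carrier V \<noteq> {\<zero>\<^bsub>V\<^esub>}"
  proof
    assume "carrier V = {\<zero>\<^bsub>V\<^esub>}"
    then have "i ` W = i ` {\<lambda>_. 0}" by (simp add: V)
    then show False using W inj W_zero inj_on_image_eq_iff[OF inj, of W "{\<lambda>_. 0}"] by simp
  qed
  moreover have "W' = {\<zero>\<^bsub>V\<^esub>} \<or> W' = carrier V"
    if W': "VectorSpace.subspace complex_field W' V" and stable: "\<And>x. x \<in> Q \<Longrightarrow> \<rho> x ` W' \<subseteq> W'" for W'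
  proof -
    have sub: "submodule complex_field W' V" using W' by simp
    have W'_subset: "W' \<subseteq> i ` W" using submodule.subset[OF sub] by (simp add: V)
    define W0 where "W0 = {f \<in> W. i f \<in> W'}"
    have eq: "W' = i ` W0" using W'_subset by (auto simp: W0_def)
    have "function_subspace X W0"
      unfolding function_subspace_def
    proof (intro conjI ballI allI impI)
      show "(\<lambda>_. 0) \<in> W0" using submodule.zero_closed[OF sub] W_zero by (simp add: W0_def V)
      show "(\<lambda>x. f x + g x) \<in> W0" if "f \<in> W0" "g \<in> W0" for f g
        using that submodule.m_closed[OF sub, of "i f" "i g"] W_add by (simp add: W0_def V)
      show "(\<lambda>x. c * f x) \<in> W0" if "f \<in> W0" for f c
        using that submodule.smult_closed[OF sub, of c "i f"] W_scale by (simp add: W0_def V)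
      show "f x = 0" if "f \<in> W0" "x \<notin> X" for f x
        using that function_subspace_support[OF W(1)] by (auto simp: W0_def)
    qed
    moreover have "T x ` W0 \<subseteq> W0" if x: "x \<in> Q" for x
    proof
      fix g assume "g \<in> T x ` W0"
      then obtain f where f: "f \<in> W0" "g = T x f" by blast
      then have "\<rho> x (i f) \<in> W'" using stable[OF x] by (auto simp: W0_def)
      then show "g \<in> W0" using f x by (simp add: W0_def \<rho> T_closed)
    qed
    ultimately have "W0 = {\<lambda>_. 0} \<or> W0 = W" by (intro irr) (auto simp: W0_def)
    then show ?thesis by (auto simp: eq V)
  qed
  ultimately have "irreducible_quandle_rep Q qop complex_field V \<rho>"
    by (auto simp: irreducible_quandle_rep_def)
  moreover have "\<exists>w\<in>W. \<forall>f\<in>W. \<exists>k. f = (\<lambda>x. k * w x)" if "has_dim complex_field V 1"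
  proof -
    have fd: "fin_dim" "dim = 1" using that by (auto simp: has_dim_def)
    obtain B where B: "finite B" "basis B" using finite_basis_exists[OF fd(1)] by blast
    then have "card B = 1" using dim_basis fd(2) by simp
    then obtain b where b: "B = {b}" by (auto simp: card_1_singleton_iff)
    then have bV: "b \<in> carrier V" and gen: "span {b} = carrier V" using B by (auto simp: basis_def)
    obtain w where w: "w \<in> W" "b = i w" using bV by (auto simp: V)
    have "\<exists>k. f = (\<lambda>x. k * w x)" if f: "f \<in> W" for f
    proof -
      have "i f \<in> span {b}" using f by (simp add: gen V)
      then obtain a where "i f = lincomb a {b}" using finite_span[of "{b}"] bV by auto
      then have "i f = a b \<odot>\<^bsub>V\<^esub> b" using bV by (simp add: lincomb_def)
      then have "i f = i (\<lambda>x. a b * w x)" using w by (simp add: V)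
      then have "f = (\<lambda>x. a b * w x)" using inj f W_scale[OF w(1)] by (auto dest: inj_onD)
      then show ?thesis by blast
    qed
    then show ?thesis using w(1) by blast
  qed
  ultimately show ?thesis using that by blast
qed

text \<open>The finite quotient inherits non-commutativity. Its translations by generators,
  restricted to a minimal stable space, give the representation, and dimension one would make that
  space a line.\<close>

lemma (in quandle) exists_irreducible_rep_not_dim_1:
  assumes fin: "finite Q" and large: "(UNIV :: complex set) \<lesssim> (UNIV :: 'v set)"
    and not_comm: "\<not> comm_group (enveloping_group Q (\<triangleright>))"
  obtains V :: "(complex, 'v) module" and \<rho> where
    "irreducible_quandle_rep Q (\<triangleright>) complex_field V \<rho>" "\<not> has_dim complex_field V 1"
proof -
  obtain n where n: "n > 0" "\<And>x y. \<lbrakk>x \<in> Q; y \<in> Q\<rbrakk> \<Longrightarrow> (((\<triangleright>) x) ^^ n) y = y"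
    using left_period[OF fin] by blast
  let ?R = "conj_rels \<union> torsion_rels n"
  let ?F = "presented_group Q ?R" and ?e = "gen_class Q ?R"
  interpret F: quandle_generated_group Q "(\<triangleright>)" ?F ?e
    by (rule quandle_generated_presented_group) simp
  interpret F: periodic_quandle_group Q "(\<triangleright>)" ?F ?e n
    by unfold_locales (use fin n in auto)
  have "?e x [^]\<^bsub>?F\<^esub> n = \<one>\<^bsub>?F\<^esub>" if x: "x \<in> Q" for x
  proof -
    have "replicate n (x, True) \<in> words Q" using x by (auto simp: words_def)
    then have "pres_cong Q ?R (replicate n (x, True)) []"
      using x by (intro pres_cong.rel) (auto simp: torsion_rels_def)
    then have "word_class Q ?R (replicate n (x, True)) = word_class Q ?R []"
      by (rule presented_group_class_eqI)
    then show ?thesis by (simp only: word_class_replicate[OF x] one_presented_group)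
  qed
  then have fin_F: "finite (carrier ?F)" by (rule F.finite_carrier)
  have not_comm_F: "\<not> comm_group ?F" using comm_group_enveloping_group[OF fin n] not_comm by blast
  obtain W where W: "function_subspace (carrier ?F) W" "W \<noteq> {\<lambda>_. 0}"
    "\<And>a. a \<in> ?e ` Q \<Longrightarrow> F.translate a ` W \<subseteq> W"
    "\<And>W'. \<lbrakk>function_subspace (carrier ?F) W'; W' \<subseteq> W; \<And>a. a \<in> ?e ` Q \<Longrightarrow> F.translate a ` W' \<subseteq> W'\<rbrakk>
      \<Longrightarrow> W' = {\<lambda>_. 0} \<or> W' = W"
    "\<not> (\<exists>w\<in>W. \<forall>f\<in>W. \<exists>k. f = (\<lambda>x. k * w x))"
    by (fact F.exists_irreducible_function_subspace[OF fin_F F.generates not_comm_F])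
  note support = function_subspace_support[OF W(1)]
  have "W \<subseteq> {f. \<forall>x. x \<notin> carrier ?F \<longrightarrow> f x = 0}" using support by blast
  then have "W \<lesssim> (UNIV :: 'v set)"
    using complex_functions_lepoll[OF fin_F] large by (meson lepoll_trans subset_imp_lepoll)
  then obtain i :: "('q word set \<Rightarrow> complex) \<Rightarrow> 'v" where i: "inj_on i W" by (auto simp: lepoll_def)
  have stable: "F.translate a ` W \<subseteq> W" if "a \<in> carrier ?F" for a
    by (rule F.translate_stable_carrier[OF fin_F F.generates _ _ that]) (fact support W(3))+
  show ?thesis
  proof (rule function_subspace_rep[of "carrier ?F" W i Q "(\<triangleright>)" "\<lambda>x. F.translate (?e x)"])
    show "bij_betw (F.translate (?e x)) W W" if x: "x \<in> Q" for x
    proof (rule bij_betw_byWitness[of _ "F.translate (inv\<^bsub>?F\<^esub> ?e x)"])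
      show "\<forall>f\<in>W. F.translate (inv\<^bsub>?F\<^esub> ?e x) (F.translate (?e x) f) = f"
        by (intro ballI F.translate_inv(1) F.e_closed x) (rule support)
      show "\<forall>f\<in>W. F.translate (?e x) (F.translate (inv\<^bsub>?F\<^esub> ?e x) f) = f"
        by (intro ballI F.translate_inv(2) F.e_closed x) (rule support)
      show "F.translate (?e x) ` W \<subseteq> W" by (intro stable F.e_closed x)
      show "F.translate (inv\<^bsub>?F\<^esub> ?e x) ` W \<subseteq> W" by (intro stable F.inv_closed F.e_closed x)
    qed
    show "F.translate (?e (x \<triangleright> y)) (F.translate (?e x) f) = F.translate (?e x) (F.translate (?e y) f)"
      if x: "x \<in> Q" and y: "y \<in> Q" for x y f
      by (simp only: F.translate_mult[symmetric] F.e_closed closed x y F.e_swap[OF x y])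
    show "W' = {\<lambda>_. 0} \<or> W' = W"
      if "function_subspace (carrier ?F) W'" "W' \<subseteq> W" "\<And>x. x \<in> Q \<Longrightarrow> F.translate (?e x) ` W' \<subseteq> W'" for W'
      using that(3) by (intro W(4) that(1,2)) blast
    fix V :: "(complex, 'v) module" and \<rho>
    assume rep: "irreducible_quandle_rep Q (\<triangleright>) complex_field V \<rho>"
      and dim: "has_dim complex_field V 1 \<Longrightarrow> \<exists>w\<in>W. \<forall>f\<in>W. \<exists>k. f = (\<lambda>x. k * w x)"
    have "\<not> has_dim complex_field V 1" using W(5) by (rule contrapos_nn) (rule dim)
    with rep show thesis by (rule that)
  qed (fact W(1,2) i closed | rule F.translate_add F.translate_scale)+
qed

theorem proposition4p5:
  fixes Q :: "'q set" and qop :: "'q \<Rightarrow> 'q \<Rightarrow> 'q"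
  assumes "quandle Q qop" and "finite Q"
    and "(UNIV :: complex set) \<lesssim> (UNIV :: 'v set)"
  shows "(\<forall>(V :: (complex, 'v) module) \<rho>.
            irreducible_quandle_rep Q qop complex_field V \<rho> \<longrightarrow> has_dim complex_field V 1)
         \<longleftrightarrow> comm_group (enveloping_group Q qop)"
proof
  assume *: "\<forall>(V :: (complex, 'v) module) \<rho>.
    irreducible_quandle_rep Q qop complex_field V \<rho> \<longrightarrow> has_dim complex_field V 1"
  show "comm_group (enveloping_group Q qop)"
  proof (rule ccontr)
    assume "\<not> comm_group (enveloping_group Q qop)"
    then obtain V :: "(complex, 'v) module" and \<rho> where
      "irreducible_quandle_rep Q qop complex_field V \<rho>" "\<not> has_dim complex_field V 1"
      using quandle.exists_irreducible_rep_not_dim_1[OF assms] by blast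
    then show False using * by blast
  qed
next
  assume "comm_group (enveloping_group Q qop)"
  then show "\<forall>(V :: (complex, 'v) module) \<rho>.
    irreducible_quandle_rep Q qop complex_field V \<rho> \<longrightarrow> has_dim complex_field V 1"
    using has_dim_1_if_comm_group countable_finite[OF assms(2)] by blast
qed

end
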